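(* Let $n$ range over powers of two. For every such $n$, let $T$ be a random tournament on alternatives $x_1,\dots,x_n$ generated according to the generalized random model with probabilities $p_{i,j}$ satisfying $p_{i,j} \in \left[100\log n/n,\ 1 - 100\log n/n\right]$ for all $i\neq j$. Then with high probability (i.e., with probability tending to $1$ as $n\to\infty$), every alternative in $T$ is a single-elimination winner; moreover, there is a polynomial-time algorithm which, with high probability, computes for each alternative a bracket under which that alternative wins.
   Context: A tournament on a finite set $V$ of alternatives is a complete orientation: for every two distinct $x,y\in V$ exactly one of $x\succ y$ ("$x$ dominates $y$") or $y\succ x$ holds. Suppose $|V|=n=2^r$. A (balanced) single-elimination tournament is a complete balanced binary tree with $n$ leaves; a bracket is a bijective assignment of the alternatives to the leaves. The winner of a leaf is the alternative at that leaf, and the winner of the subtree rooted at an internal node $u$ is whichever of the winners of the two child subtrees dominates the other. An alternative is a single-elimination winner if there is a bracket under which it is the winner at the root. Generalized random model: for each ordered pair $i\neq j$ there is a number $p_{i,j}\in[0,1]$ with $p_{i,j}+p_{j,i}=1$; independently for each unordered pair $\{i,j\}$, $x_i\succ x_j$ with probability $p_{i,j}$ and otherwise $x_j\succ x_i$. $\log$ is the natural logarithm. *)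

theory Defs
  imports "HOL-Probability.Probability" "HOL-Computational_Algebra.Polynomial"
begin

section \<open>Tournaments and single-elimination brackets\<close>

text \<open>\<open>(x, y) \<in> T\<close> means that \<open>x\<close> dominates \<open>y\<close>.\<close>

definition is_tournament :: "'a set \<Rightarrow> ('a \<times> 'a) set \<Rightarrow> bool" where
  "is_tournament V T \<longleftrightarrow>
     finite V \<and> T \<subseteq> V \<times> V \<and> (\<forall>x\<in>V. (x, x) \<notin> T) \<and>
     (\<forall>x\<in>V. \<forall>y\<in>V. x \<noteq> y \<longrightarrow> ((x, y) \<in> T \<longleftrightarrow> (y, x) \<notin> T))"

text \<open>
  In the complete binary tree with \<open>2 ^ r\<close> leaves numbered from left to right, the nodes at
  height \<open>h\<close> are numbered \<open>0, \<dots>, 2 ^ (r - h) - 1\<close> from left to right; node \<open>k\<close> at height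
  \<open>Suc h\<close> has the children \<open>2 * k\<close> and \<open>2 * k + 1\<close> at height \<open>h\<close>, and the root is node \<open>0\<close> at
  height \<open>r\<close>. A bracket maps leaf numbers to alternatives.
\<close>

definition is_bracket :: "'a set \<Rightarrow> nat \<Rightarrow> (nat \<Rightarrow> 'a) \<Rightarrow> bool" where
  "is_bracket V r b \<longleftrightarrow> bij_betw b {..<2 ^ r} V"

fun subtree_winner :: "('a \<times> 'a) set \<Rightarrow> (nat \<Rightarrow> 'a) \<Rightarrow> nat \<Rightarrow> nat \<Rightarrow> 'a" where
  "subtree_winner T b 0 k = b k"
| "subtree_winner T b (Suc h) k =
     (let x = subtree_winner T b h (2 * k); y = subtree_winner T b h (2 * k + 1)
      in if (x, y) \<in> T then x else y)"

definition wins_under :: "'a set \<Rightarrow> ('a \<times> 'a) set \<Rightarrow> nat \<Rightarrow> (nat \<Rightarrow> 'a) \<Rightarrow> 'a \<Rightarrow> bool" where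
  "wins_under V T r b x \<longleftrightarrow> is_bracket V r b \<and> subtree_winner T b r 0 = x"

definition single_elimination_winner :: "'a set \<Rightarrow> ('a \<times> 'a) set \<Rightarrow> 'a \<Rightarrow> bool" where
  "single_elimination_winner V T x \<longleftrightarrow> (\<exists>r b. wins_under V T r b x)"


section \<open>The generalized random model\<close>

text \<open>The alternatives \<open>x\<^sub>1, \<dots>, x\<^sub>n\<close> are represented by \<open>0, \<dots>, n - 1\<close>.\<close>

definition model_probabilities :: "nat \<Rightarrow> (nat \<Rightarrow> nat \<Rightarrow> real) \<Rightarrow> bool" where
  "model_probabilities n p \<longleftrightarrow>
     (\<forall>i<n. \<forall>j<n. i \<noteq> j \<longrightarrow> p i j \<in> {0..1} \<and> p i j + p j i = 1)"

text \<open>One independent coin per unordered pair, indexed by the pair \<open>(i, j)\<close> with \<open>i < j\<close>;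
  the coin shows whether \<open>i\<close> dominates \<open>j\<close>.\<close>

definition random_tournament :: "nat \<Rightarrow> (nat \<Rightarrow> nat \<Rightarrow> real) \<Rightarrow> (nat \<times> nat) set pmf" where
  "random_tournament n p =
     map_pmf (\<lambda>c. {(i, j). i < n \<and> j < n \<and> (i < j \<and> c (i, j) \<or> j < i \<and> \<not> c (j, i))})
       (Pi_pmf {(i, j). i < j \<and> j < n} False (\<lambda>(i, j). bernoulli_pmf (p i j)))"

lemma is_tournament_random_tournament:
  "T \<in> set_pmf (random_tournament n p) \<Longrightarrow> is_tournament {..<n} T"
  by (auto simp: random_tournament_def is_tournament_def)

lemma prob_random_tournament_edge:
  assumes "model_probabilities n p" "i < n" "j < n" "i \<noteq> j"
  shows "measure_pmf.prob (random_tournament n p) {T. (i, j) \<in> T} = p i j"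
proof -
  have fin: "finite {(i, j). i < j \<and> j < n}"
    by (rule finite_subset[of _ "{..<n} \<times> {..<n}"]) auto
  have marg: "measure_pmf.prob (Pi_pmf {(i, j). i < j \<and> j < n} False
        (\<lambda>(i, j). bernoulli_pmf (p i j))) {c. c (a, b) = v} = pmf (bernoulli_pmf (p a b)) v"
    if "a < b" "b < n" for a b v
  proof -
    have "map_pmf (\<lambda>c. c (a, b)) (Pi_pmf {(i, j). i < j \<and> j < n} False
        (\<lambda>(i, j). bernoulli_pmf (p i j))) = bernoulli_pmf (p a b)"
      using that by (subst Pi_pmf_component[OF fin]) auto
    from this[symmetric] show ?thesis
      by (simp add: pmf_map vimage_def)
  qed
  have p: "p i j \<in> {0..1}" "p j i \<in> {0..1}" "p i j + p j i = 1"
    using assms by (auto simp: model_probabilities_def)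
  show ?thesis
  proof (cases "i < j")
    case True
    then have "measure_pmf.prob (random_tournament n p) {T. (i, j) \<in> T} = pmf (bernoulli_pmf (p i j)) True"
      using assms marg[of i j True] by (simp add: random_tournament_def vimage_def)
    then show ?thesis using p by simp
  next
    case False
    then have "measure_pmf.prob (random_tournament n p) {T. (i, j) \<in> T} = pmf (bernoulli_pmf (p j i)) False"
      using assms marg[of j i False] by (simp add: random_tournament_def vimage_def)
    then show ?thesis using p by simp
  qed
qed

text \<open>
  A family of models, one for each \<open>n = 2 ^ r\<close>. The interval is empty for small \<open>n\<close>, so
  the range condition can only be imposed for all sufficiently large \<open>r\<close>.
\<close>

definition admissible_models :: "(nat \<Rightarrow> nat \<Rightarrow> nat \<Rightarrow> real) \<Rightarrow> bool" where
  "admissible_models p \<longleftrightarrow>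
     (\<forall>r. model_probabilities (2 ^ r) (p r)) \<and>
     (\<forall>\<^sub>F r in sequentially. \<forall>i<2 ^ r. \<forall>j<2 ^ r. i \<noteq> j \<longrightarrow>
        p r i j \<in> {100 * ln (2 ^ r) / 2 ^ r .. 1 - 100 * ln (2 ^ r) / 2 ^ r})"


section \<open>Polynomial-time algorithms\<close>

text \<open>
  The machine model is a random access machine with structured control. Its memory consists of
  natural-number cells addressed by an array name and two indices, and all addressing may be
  indirect. The only arithmetic operations are addition and truncated subtraction, so within
  \<open>t\<close> steps on \<open>n\<close> alternatives only numbers of \<open>O(t + log n)\<close> bits can arise; hence
  unit-cost time in this model is polynomially equivalent to Turing machine time.
\<close>

datatype expr =
    Num nat
  | Cell string expr expr
  | Add expr expr
  | Sub expr expr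

datatype prog =
    Skip
  | Write string expr expr expr
  | Seq prog prog
  | Cond expr prog prog
  | While expr prog

type_synonym store = "string \<times> nat \<times> nat \<Rightarrow> nat"

fun expr_val :: "store \<Rightarrow> expr \<Rightarrow> nat" where
  "expr_val s (Num k) = k"
| "expr_val s (Cell a e f) = s (a, expr_val s e, expr_val s f)"
| "expr_val s (Add e f) = expr_val s e + expr_val s f"
| "expr_val s (Sub e f) = expr_val s e - expr_val s f"

text \<open>
  \<open>exec c s t s'\<close>: started in store \<open>s\<close>, the program \<open>c\<close> halts in store \<open>s'\<close> after \<open>t\<close> steps.
  Evaluating an expression is charged one step; the expressions of a fixed program
  have bounded size, so this affects running times by a constant factor only.
  Conditions hold if they evaluate to a nonzero value.
\<close>

inductive exec :: "prog \<Rightarrow> store \<Rightarrow> nat \<Rightarrow> store \<Rightarrow> bool" where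
  exec_Skip: "exec Skip s 1 s"
| exec_Write: "exec (Write a e f g) s 1 (s((a, expr_val s e, expr_val s f) := expr_val s g))"
| exec_Seq: "exec c s t s' \<Longrightarrow> exec d s' u s'' \<Longrightarrow> exec (Seq c d) s (t + u) s''"
| exec_CondTrue: "expr_val s e \<noteq> 0 \<Longrightarrow> exec c s t s' \<Longrightarrow> exec (Cond e c d) s (Suc t) s'"
| exec_CondFalse: "expr_val s e = 0 \<Longrightarrow> exec d s t s' \<Longrightarrow> exec (Cond e c d) s (Suc t) s'"
| exec_WhileFalse: "expr_val s e = 0 \<Longrightarrow> exec (While e c) s 1 s"
| exec_WhileTrue: "expr_val s e \<noteq> 0 \<Longrightarrow> exec c s t s' \<Longrightarrow> exec (While e c) s' u s'' \<Longrightarrow>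
    exec (While e c) s (Suc (t + u)) s''"

inductive_cases exec_SkipE: "exec Skip s t s'"
inductive_cases exec_WriteE: "exec (Write a e f g) s t s'"
inductive_cases exec_SeqE: "exec (Seq c d) s t s'"
inductive_cases exec_CondE: "exec (Cond e c d) s t s'"
inductive_cases exec_WhileE: "exec (While e c) s t s'"

lemma exec_deterministic:
  "exec c s t s' \<Longrightarrow> exec c s u s'' \<Longrightarrow> u = t \<and> s'' = s'"
proof (induction arbitrary: u s'' rule: exec.induct)
  case (exec_Seq c s t s' d v s2)
  from exec_Seq.prems show ?case
  proof (rule exec_SeqE)
    fix t1 s1 u1
    assume *: "exec c s t1 s1" "exec d s1 u1 s''" "u = t1 + u1"
    have 1: "t1 = t" "s1 = s'"
      using exec_Seq.IH(1)[OF *(1)] by blast+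
    have "u1 = v" "s'' = s2"
      using exec_Seq.IH(2)[OF *(2)[unfolded 1(2)]] by blast+
    with 1 *(3) show ?thesis by blast
  qed
next
  case (exec_CondTrue s e c t s' d)
  from exec_CondTrue.prems show ?case
  proof (rule exec_CondE)
    fix t1
    assume *: "u = Suc t1" "exec c s t1 s''"
    show ?thesis using exec_CondTrue.IH[OF *(2)] *(1) by blast
  qed (use exec_CondTrue.hyps in simp_all)
next
  case (exec_CondFalse s e d t s' c)
  from exec_CondFalse.prems show ?case
  proof (rule exec_CondE)
    fix t1
    assume *: "u = Suc t1" "exec d s t1 s''"
    show ?thesis using exec_CondFalse.IH[OF *(2)] *(1) by blast
  qed (use exec_CondFalse.hyps in simp_all)
next
  case (exec_WhileFalse s e c)
  from exec_WhileFalse.prems show ?case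
    by (rule exec_WhileE) (use exec_WhileFalse.hyps in simp_all)
next
  case (exec_WhileTrue s e c t s' v s2)
  from exec_WhileTrue.prems show ?case
  proof (rule exec_WhileE)
    fix t1 s1 u1
    assume *: "exec c s t1 s1" "exec (While e c) s1 u1 s''" "u = Suc (t1 + u1)"
    have 1: "t1 = t" "s1 = s'"
      using exec_WhileTrue.IH(1)[OF *(1)] by blast+
    have "u1 = v" "s'' = s2"
      using exec_WhileTrue.IH(2)[OF *(2)[unfolded 1(2)]] by blast+
    with 1 *(3) show ?thesis by blast
  qed (use exec_WhileTrue.hyps in simp_all)
qed (auto elim: exec_SkipE exec_WriteE)

text \<open>The input is the number of alternatives and the adjacency matrix of the tournament; all
  other cells initially contain \<open>0\<close>.\<close>

definition input_store :: "nat \<Rightarrow> (nat \<times> nat) set \<Rightarrow> store" where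
  "input_store n T = (\<lambda>(a, i, j).
     if a = ''n'' \<and> i = 0 \<and> j = 0 then n
     else if a = ''dominates'' \<and> (i, j) \<in> T then 1
     else 0)"

text \<open>The input has size polynomial in the number \<open>n\<close> of alternatives and at least \<open>n\<^sup>2\<close>, so
  the running time may be measured in terms of \<open>n\<close>.\<close>

definition polynomial_time :: "prog \<Rightarrow> bool" where
  "polynomial_time c \<longleftrightarrow>
     (\<exists>q :: nat poly. \<forall>r T. is_tournament {..<2 ^ r} T \<longrightarrow>
        (\<exists>t s. exec c (input_store (2 ^ r) T) t s \<and> t \<le> poly q (2 ^ r)))"

text \<open>In the output, row \<open>x\<close> of the array \<open>''bracket''\<close> lists the bracket computed for the
  alternative \<open>x\<close>, leaf by leaf.\<close>

definition computes_winning_brackets :: "prog \<Rightarrow> nat \<Rightarrow> (nat \<times> nat) set \<Rightarrow> bool" where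
  "computes_winning_brackets c r T \<longleftrightarrow>
     (\<exists>t s. exec c (input_store (2 ^ r) T) t s \<and>
        (\<forall>x<2 ^ r. wins_under {..<2 ^ r} T r (\<lambda>k. s (''bracket'', x, k)) x))"

end

theory Submission
  imports Defs
begin

text \<open>
  Let \<open>n = 2 ^ r\<close>. To make \<open>x\<close> win, embed the binomial tree with \<open>n / 2\<close> nodes into the
  tournament with root \<open>x\<close>: visit the nodes in increasing order and let each one take its at most
  \<open>r - 1\<close> children among the unused alternatives of a pool of size \<open>9 n / 16\<close>. A visited alternative
  is compared with fresh alternatives only, at least \<open>n / 16\<close> of which are available, so by a Chernoff
  bound a visit fails with probability at most \<open>2 ^ r * exp (- (100 ln n / n) * n / 32)\<close>, which is
  small enough for a union bound over all nodes and all \<open>x\<close>. It remains to match the \<open>n / 2\<close>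
  alternatives in the tree perfectly to the other \<open>n / 2\<close>, whom they beat in the first round. Given
  the tree, the pairs that have not been compared are independent, and a union bound over the
  possible obstructions shows that Hall's condition holds. The matching is found by an auction:
  a bidder takes a cheapest acceptable item and raises its price by one.
\<close>

text \<open>One tournament has to supply both the tree and the matching, so the search for the tree
  must not spend all its randomness. The pool confines what is inspected: about 7/8 of the
  alternatives left for the matching are never looked at, and nodes with odd numbers, having no
  children, inspect nobody. The size 9n/16 is a compromise: what the tree leaves of the pool must be
  large enough for the Chernoff bound, yet a small part of the alternatives to be matched. The
  constant 100 is governed by the tree: alternatives, nodes and the Chernoff prefactor contribute at
  most n^3, against n^(-100/32), and 100/32 > 3. The matching only needs 100/12 > 8.

  The algorithm is deterministic and shaped by the machine: all loops run to n and powers of two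
  arise by doubling. An auction needs no search structure as augmenting paths do, only n^2 identical
  bids per bidder, with the sum of the prices as potential.\<close>

section \<open>Programs with bounded loops\<close>

text \<open>
  Programs all of whose loops run over \<open>0, \<dots>, n - 1\<close>: these terminate in polynomial time on every
  input, and their effect is a total function on stores.
\<close>

datatype for_prog =
    FSkip
  | FWrite string expr expr expr
  | FSeq for_prog for_prog
  | FCond expr for_prog for_prog
  | FFor string for_prog

abbreviation Var :: "string \<Rightarrow> expr" where
  "Var v \<equiv> Cell v (Num 0) (Num 0)"

primrec compile :: "for_prog \<Rightarrow> prog" where
  "compile FSkip = Skip"
| "compile (FWrite a e f g) = Write a e f g"
| "compile (FSeq c d) = Seq (compile c) (compile d)"
| "compile (FCond e c d) = Cond e (compile c) (compile d)"
| "compile (FFor v c) = Seq (Write v (Num 0) (Num 0) (Num 0))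
     (While (Sub (Var ''n'') (Var v))
       (Seq (compile c) (Write v (Num 0) (Num 0) (Add (Var v) (Num 1)))))"

text \<open>A loop is iterated as often as \<open>n\<close> says on entry. The compiled
  \<open>While\<close> reads \<open>n\<close> and the counter again before each round, so the two
  agree for bodies that write neither; \<open>wf_for\<close> asks for this.\<close>

primrec sem :: "for_prog \<Rightarrow> store \<Rightarrow> store" where
  "sem FSkip s = s"
| "sem (FWrite a e f g) s = s((a, expr_val s e, expr_val s f) := expr_val s g)"
| "sem (FSeq c d) s = sem d (sem c s)"
| "sem (FCond e c d) s = (if expr_val s e \<noteq> 0 then sem c s else sem d s)"
| "sem (FFor v c) s =
     ((\<lambda>s. (sem c s)((v, 0, 0) := Suc (s (v, 0, 0)))) ^^ s (''n'', 0, 0)) (s((v, 0, 0) := 0))"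

primrec written :: "for_prog \<Rightarrow> string set" where
  "written FSkip = {}"
| "written (FWrite a e f g) = {a}"
| "written (FSeq c d) = written c \<union> written d"
| "written (FCond e c d) = written c \<union> written d"
| "written (FFor v c) = insert v (written c)"

primrec wf_for :: "for_prog \<Rightarrow> bool" where
  "wf_for FSkip = True"
| "wf_for (FWrite a e f g) = (a \<noteq> ''n'')"
| "wf_for (FSeq c d) = (wf_for c \<and> wf_for d)"
| "wf_for (FCond e c d) = (wf_for c \<and> wf_for d)"
| "wf_for (FFor v c) = (v \<noteq> ''n'' \<and> v \<notin> written c \<and> wf_for c)"

text \<open>A polynomial in the value of \<open>n\<close>. Each round of a loop adds a test and an
  increment to its body; the leading 2 pays for resetting the counter and for the test that ends the
  loop.\<close>

primrec time_poly :: "for_prog \<Rightarrow> nat poly" where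
  "time_poly FSkip = 1"
| "time_poly (FWrite a e f g) = 1"
| "time_poly (FSeq c d) = time_poly c + time_poly d"
| "time_poly (FCond e c d) = 1 + time_poly c + time_poly d"
| "time_poly (FFor v c) = 2 + [:0, 1:] * (time_poly c + 2)"

text \<open>The outer loop runs over the alternatives \<open>x\<close>. Confining writes to row
  \<open>x\<close> protects the results for other alternatives and keeps their rows empty until
  their turn.\<close>

primrec row_writes :: "string \<Rightarrow> for_prog \<Rightarrow> bool" where
  "row_writes a FSkip = True"
| "row_writes a (FWrite a' e f g) = (a' = a \<longrightarrow> e = Var ''x'')"
| "row_writes a (FSeq c d) = (row_writes a c \<and> row_writes a d)"
| "row_writes a (FCond e c d) = (row_writes a c \<and> row_writes a d)"
| "row_writes a (FFor v c) = (v \<noteq> a \<and> row_writes a c)"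

lemma sem_unwritten: "a \<notin> written c \<Longrightarrow> sem c s (a, i, j) = s (a, i, j)"
proof (induction c arbitrary: s)
  case (FFor v c)
  have "((\<lambda>s. (sem c s)((v, 0, 0) := Suc (s (v, 0, 0)))) ^^ k) s' (a, i, j) = s' (a, i, j)" for k s'
    by (induction k) (use FFor in auto)
  then show ?case using FFor.prems by auto
qed auto

lemma sem_other_row:
  "row_writes a c \<Longrightarrow> ''x'' \<notin> written c \<Longrightarrow> i \<noteq> s (''x'', 0, 0) \<Longrightarrow> sem c s (a, i, j) = s (a, i, j)"
proof (induction c arbitrary: s)
  case (FFor v c)
  have "((\<lambda>s. (sem c s)((v, 0, 0) := Suc (s (v, 0, 0)))) ^^ k) s' (a, i, j) = s' (a, i, j)"
    if "i \<noteq> s' (''x'', 0, 0)" for k s'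
  proof -
    have "((\<lambda>s. (sem c s)((v, 0, 0) := Suc (s (v, 0, 0)))) ^^ k) s' (''x'', 0, 0) = s' (''x'', 0, 0) \<and>
      ((\<lambda>s. (sem c s)((v, 0, 0) := Suc (s (v, 0, 0)))) ^^ k) s' (a, i, j) = s' (a, i, j)"
      by (induction k) (use FFor that in \<open>auto simp: sem_unwritten\<close>)
    then show ?thesis by blast
  qed
  then show ?case using FFor.prems by auto
qed (auto simp: sem_unwritten)

lemma wf_for_n: "wf_for c \<Longrightarrow> ''n'' \<notin> written c"
  by (induction c) auto

lemma exec_compile:
  "wf_for c \<Longrightarrow> \<exists>t\<le>poly (time_poly c) (s (''n'', 0, 0)). exec (compile c) s t (sem c s)"
proof (induction c arbitrary: s)
  case FSkip
  have "exec (compile FSkip) s 1 (sem FSkip s)"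
    by (simp only: compile.simps sem.simps exec_Skip)
  then show ?case by (intro exI[of _ 1]) auto
next
  case (FWrite a e f g)
  have "exec (compile (FWrite a e f g)) s 1 (sem (FWrite a e f g) s)"
    by (simp only: compile.simps sem.simps exec_Write)
  then show ?case by (intro exI[of _ 1]) (auto simp del: compile.simps sem.simps)
next
  case (FSeq c d)
  obtain t where t: "t \<le> poly (time_poly c) (s (''n'', 0, 0))" "exec (compile c) s t (sem c s)"
    using FSeq by auto
  have n: "sem c s (''n'', 0, 0) = s (''n'', 0, 0)"
    using FSeq.prems by (intro sem_unwritten wf_for_n) auto
  obtain u where u: "u \<le> poly (time_poly d) (s (''n'', 0, 0))" "exec (compile d) (sem c s) u (sem d (sem c s))"
    using FSeq n by (metis wf_for.simps(3))
  show ?case using t u by (auto intro!: exI[of _ "t + u"] exec.intros)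
next
  case (FCond e c d)
  show ?case
  proof (cases "expr_val s e = 0")
    case True
    obtain t where "t \<le> poly (time_poly d) (s (''n'', 0, 0))" "exec (compile d) s t (sem d s)"
      using FCond by auto
    then show ?thesis using True by (auto intro!: exI[of _ "Suc t"] exec_CondFalse)
  next
    case False
    obtain t where "t \<le> poly (time_poly c) (s (''n'', 0, 0))" "exec (compile c) s t (sem c s)"
      using FCond by auto
    then show ?thesis using False by (auto intro!: exI[of _ "Suc t"] exec_CondTrue)
  qed
next
  case (FFor v c)
  let ?F = "\<lambda>s. (sem c s)((v, 0, 0) := Suc (s (v, 0, 0)))"
  let ?W = "While (Sub (Var ''n'') (Var v))
       (Seq (compile c) (Write v (Num 0) (Num 0) (Add (Var v) (Num 1))))"
  define N where "N = s (''n'', 0, 0)"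
  define B where "B = poly (time_poly c) N"
  have wf: "v \<noteq> ''n''" "v \<notin> written c" "wf_for c" using FFor.prems by auto
  have loop: "\<exists>t\<le>1 + k * (B + 2). exec ?W s' t ((?F ^^ k) s')"
    if "s' (''n'', 0, 0) = N" "s' (v, 0, 0) + k = N" for k s'
    using that
  proof (induction k arbitrary: s')
    case 0
    then show ?case by (auto intro!: exI[of _ 1] exec_WhileFalse)
  next
    case (Suc k)
    obtain t where t: "t \<le> B" "exec (compile c) s' t (sem c s')"
      using FFor.IH[OF wf(3)] Suc.prems(1) unfolding B_def by metis
    have v: "sem c s' (v, 0, 0) = s' (v, 0, 0)" "sem c s' (''n'', 0, 0) = s' (''n'', 0, 0)"
      using wf by (auto intro!: sem_unwritten dest: wf_for_n)
    have body: "exec (Seq (compile c) (Write v (Num 0) (Num 0) (Add (Var v) (Num 1)))) s' (t + 1) (?F s')"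
      by (rule exec_Seq[OF t(2)])
        (use exec_Write[of v "Num 0" "Num 0" "Add (Var v) (Num 1)" "sem c s'"] v in simp)
    have "\<exists>u\<le>1 + k * (B + 2). exec ?W (?F s') u ((?F ^^ k) (?F s'))"
      by (rule Suc.IH) (use Suc.prems v wf in auto)
    then obtain u where u: "u \<le> 1 + k * (B + 2)" "exec ?W (?F s') u ((?F ^^ k) (?F s'))"
      by blast
    have "exec ?W s' (Suc (t + 1 + u)) ((?F ^^ k) (?F s'))"
      by (rule exec_WhileTrue[OF _ body u(2)]) (use Suc.prems in auto)
    then have "exec ?W s' (Suc (t + 1 + u)) ((?F ^^ Suc k) s')"
      by (simp only: funpow_Suc_right o_apply)
    moreover have "Suc (t + 1 + u) \<le> 1 + Suc k * (B + 2)"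
      using t(1) u(1) by simp
    ultimately show ?case by blast
  qed
  obtain t where t: "t \<le> 1 + N * (B + 2)" "exec ?W (s((v, 0, 0) := 0)) t ((?F ^^ N) (s((v, 0, 0) := 0)))"
    using loop[of "s((v, 0, 0) := 0)" N] wf unfolding N_def by auto
  have "exec (compile (FFor v c)) s (1 + t) (sem (FFor v c) s)"
    using exec_Seq[OF exec_Write[of v "Num 0" "Num 0" "Num 0" s]] t(2) by (simp add: N_def)
  then show ?case using t(1)
    by (intro exI[of _ "1 + t"]) (auto simp: N_def B_def)
qed

text \<open>The Hoare rule for counted loops. \<open>I k\<close> describes the store after
  \<open>k\<close> rounds with the counter already set to \<open>k\<close>, so each use also checks
  that \<open>I\<close> survives writing the counter.\<close>

lemma sem_For_invariant:
  assumes "wf_for (FFor v c)" "s (''n'', 0, 0) = n"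
    and init: "I 0 (s((v, 0, 0) := 0))"
    and step: "\<And>k s. k < n \<Longrightarrow> s (v, 0, 0) = k \<Longrightarrow> s (''n'', 0, 0) = n \<Longrightarrow> I k s \<Longrightarrow>
      I (Suc k) ((sem c s)((v, 0, 0) := Suc k))"
  shows "I n (sem (FFor v c) s)"
proof -
  let ?F = "\<lambda>s. (sem c s)((v, 0, 0) := Suc (s (v, 0, 0)))"
  let ?s = "s((v, 0, 0) := 0)"
  have "I k ((?F ^^ k) ?s) \<and> (?F ^^ k) ?s (v, 0, 0) = k \<and> (?F ^^ k) ?s (''n'', 0, 0) = n"
    if "k \<le> n" for k
    using that
  proof (induction k)
    case (Suc k)
    define s' where "s' = (?F ^^ k) ?s"
    have s': "I k s'" "s' (v, 0, 0) = k" "s' (''n'', 0, 0) = n"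
      using Suc.IH[OF Suc_leD[OF Suc.prems]] unfolding s'_def by blast+
    have "(?F ^^ Suc k) ?s = (sem c s')((v, 0, 0) := Suc k)"
      using s'(2) by (simp only: funpow.simps o_apply flip: s'_def)
    moreover have "I (Suc k) ((sem c s')((v, 0, 0) := Suc k))"
      by (rule step) (use s' Suc.prems in auto)
    moreover have "((sem c s')((v, 0, 0) := Suc k)) (v, 0, 0) = Suc k"
      "((sem c s')((v, 0, 0) := Suc k)) (''n'', 0, 0) = n"
      using assms(1) s' by (auto simp: sem_unwritten wf_for_n)
    ultimately show ?case by (simp only: simp_thms)
  qed (use assms in auto)
  then show ?thesis using assms(2) by (simp only: sem.simps)
qed

section \<open>Independence in the random model\<close>

text \<open>Opposite ordered pairs are decided by one coin, and this is its name. Independence is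
  therefore a matter of disjoint images under \<open>pair_key\<close>, not of disjoint sets of
  pairs.\<close>

definition pair_key :: "nat \<times> nat \<Rightarrow> nat \<times> nat" where
  "pair_key e = (min (fst e) (snd e), max (fst e) (snd e))"

definition coin_tournament :: "nat \<Rightarrow> (nat \<times> nat \<Rightarrow> bool) \<Rightarrow> (nat \<times> nat) set" where
  "coin_tournament n c = {(i, j). i < n \<and> j < n \<and> (i < j \<and> c (i, j) \<or> j < i \<and> \<not> c (j, i))}"

abbreviation coin_pmf :: "nat \<Rightarrow> (nat \<Rightarrow> nat \<Rightarrow> real) \<Rightarrow> (nat \<times> nat \<Rightarrow> bool) pmf" where
  "coin_pmf n p \<equiv> Pi_pmf {(i, j). i < j \<and> j < n} False (\<lambda>(i, j). bernoulli_pmf (p i j))"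

lemma random_tournament_coins:
  "random_tournament n p = map_pmf (coin_tournament n) (coin_pmf n p)"
  by (simp add: random_tournament_def coin_tournament_def[abs_def])

lemma finite_coins: "finite {(i, j). i < j \<and> j < (n::nat)}"
  by (rule finite_subset[of _ "{..<n} \<times> {..<n}"]) auto

definition determined_by :: "(nat \<times> nat) set set \<Rightarrow> (nat \<times> nat) set \<Rightarrow> bool" where
  "determined_by E C \<longleftrightarrow> (\<forall>T T'. T \<in> E \<longrightarrow> T \<inter> C = T' \<inter> C \<longrightarrow> T' \<in> E)"

lemma coin_tournament_agree:
  assumes "\<And>k. k \<in> pair_key ` C \<Longrightarrow> c k = c' k"
  shows "coin_tournament n c \<inter> C = coin_tournament n c' \<inter> C"
proof -
  have "e \<in> coin_tournament n c \<longleftrightarrow> e \<in> coin_tournament n c'" if "e \<in> C" for e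
  proof -
    obtain i j where e: "e = (i, j)" by (cases e)
    have "c (min i j, max i j) = c' (min i j, max i j)"
      using assms[OF imageI[OF that]] by (simp add: pair_key_def e)
    then show ?thesis
      by (cases "i < j") (auto simp: e coin_tournament_def min_def max_def)
  qed
  then show ?thesis by auto
qed

text \<open>The coins named by \<open>C\<close> and the remaining ones form a product space;
  \<open>E\<close> is a cylinder over the first factor and, by disjointness of the keys,
  \<open>F\<close> is one over the second.\<close>

lemma prob_determined_independent:
  assumes "determined_by E C" "determined_by F D" "pair_key ` C \<inter> pair_key ` D = {}"
  shows "measure_pmf.prob (random_tournament n p) (E \<inter> F) =
    measure_pmf.prob (random_tournament n p) E * measure_pmf.prob (random_tournament n p) F"
proof -
  let ?I = "{(i, j). i < j \<and> j < n}"
  let ?q = "\<lambda>(i, j). bernoulli_pmf (p i j)"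
  define A where "A = ?I \<inter> pair_key ` C"
  define B where "B = ?I - pair_key ` C"
  let ?M = "pair_pmf (Pi_pmf A False ?q) (Pi_pmf B False ?q)"
  define g where "g = (\<lambda>(f, h) x. if x \<in> A then f x else h x :: bool)"
  define mA where "mA = (\<lambda>f. coin_tournament n (g (f, \<lambda>_. False)))"
  define mB where "mB = (\<lambda>h. coin_tournament n (g (\<lambda>_. False, h)))"
  have AB: "finite A" "finite B" "A \<inter> B = {}" "?I = A \<union> B"
    using finite_coins[of n] by (auto simp: A_def B_def)
  have rt: "random_tournament n p = map_pmf (\<lambda>z. coin_tournament n (g z)) ?M"
    unfolding random_tournament_coins AB(4) Pi_pmf_union[OF AB(1-3)]
    by (simp add: pmf.map_comp o_def g_def case_prod_unfold)
  have eqC: "coin_tournament n (g (f, h)) \<inter> C = mA f \<inter> C" for f h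
  proof -
    \<comment> \<open>Keys of \<open>C\<close> may lie outside \<open>?I\<close>, for instance on
      the diagonal. Coins there are never read, so they are set to \<open>False\<close> before
      comparing.\<close>
    have "coin_tournament n (g (f, h)) \<inter> C = coin_tournament n (\<lambda>k. if k \<in> ?I then g (f, h) k else False) \<inter> C" for f h
      by (auto simp: coin_tournament_def)
    moreover have "coin_tournament n (\<lambda>k. if k \<in> ?I then g (f, h) k else False) \<inter> C =
      coin_tournament n (\<lambda>k. if k \<in> ?I then g (f, \<lambda>_. False) k else False) \<inter> C"
      by (rule coin_tournament_agree) (auto simp: g_def A_def)
    ultimately show ?thesis by (simp add: mA_def)
  qed
  have eqD: "coin_tournament n (g (f, h)) \<inter> D = mB h \<inter> D" for f h
    unfolding mB_def by (rule coin_tournament_agree) (use assms(3) in \<open>auto simp: g_def A_def\<close>)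
  have E: "coin_tournament n (g (f, h)) \<in> E \<longleftrightarrow> mA f \<in> E" for f h
    using assms(1) eqC[of f h] unfolding determined_by_def by metis
  have F: "coin_tournament n (g (f, h)) \<in> F \<longleftrightarrow> mB h \<in> F" for f h
    using assms(2) eqD[of f h] unfolding determined_by_def by metis
  have *: "measure_pmf.prob (random_tournament n p) X =
      measure_pmf.prob ?M {(f, h). coin_tournament n (g (f, h)) \<in> X}" for X
    unfolding rt by (simp add: vimage_def case_prod_unfold)
  have prod: "measure_pmf.prob ?M (S \<times> S') =
      measure_pmf.prob (Pi_pmf A False ?q) S * measure_pmf.prob (Pi_pmf B False ?q) S'" for S S'
  proof -
    have "measure_pmf.prob ?M (S \<times> S') = measure_pmf.prob ?M
       ((S \<inter> set_pmf (Pi_pmf A False ?q)) \<times> (S' \<inter> set_pmf (Pi_pmf B False ?q)))"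
      by (rule measure_prob_cong_0) (auto simp: pmf_eq_0_set_pmf)
    also have "\<dots> = measure_pmf.prob (Pi_pmf A False ?q) (S \<inter> set_pmf (Pi_pmf A False ?q)) *
       measure_pmf.prob (Pi_pmf B False ?q) (S' \<inter> set_pmf (Pi_pmf B False ?q))"
      by (rule measure_pmf_prob_product) (auto intro: countable_subset)
    finally show ?thesis by (simp add: measure_Int_set_pmf)
  qed
  have "{(f, h). coin_tournament n (g (f, h)) \<in> E \<inter> F} = {f. mA f \<in> E} \<times> {h. mB h \<in> F}"
    "{(f, h). coin_tournament n (g (f, h)) \<in> E} = {f. mA f \<in> E} \<times> UNIV"
    "{(f, h). coin_tournament n (g (f, h)) \<in> F} = UNIV \<times> {h. mB h \<in> F}"
    using E F by auto
  then show ?thesis unfolding * by (simp only: prod) simp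
qed

lemma finite_set_pmf_random_tournament: "finite (set_pmf (random_tournament n p))"
proof -
  have "set_pmf (random_tournament n p) \<subseteq> Pow ({..<n} \<times> {..<n})"
    by (auto simp: random_tournament_def)
  then show ?thesis by (rule finite_subset) auto
qed

text \<open>
  A form of deferred decisions: \<open>H T\<close> is what has been revealed of the tournament, \<open>C h\<close> contains
  the pairs inspected in order to learn that \<open>H T = h\<close>, and the bad event \<open>F h\<close> only concerns other pairs.
\<close>

lemma prob_adaptive_le:
  fixes \<epsilon> :: real
  assumes "\<And>h. h \<in> G \<Longrightarrow> determined_by {T. good T \<and> H T = h} (C h)"
    and "\<And>h. h \<in> G \<Longrightarrow> determined_by (F h) (D h)"
    and "\<And>h. h \<in> G \<Longrightarrow> pair_key ` C h \<inter> pair_key ` D h = {}"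
    and le: "\<And>h. h \<in> G \<Longrightarrow> measure_pmf.prob (random_tournament n p) (F h) \<le> \<epsilon>"
    and "\<epsilon> \<ge> 0"
    and G: "\<And>T. good T \<Longrightarrow> H T \<in> G"
  shows "measure_pmf.prob (random_tournament n p) {T. good T \<and> T \<in> F (H T)} \<le> \<epsilon>"
proof -
  let ?M = "random_tournament n p"
  let ?P = "measure_pmf.prob ?M"
  have fin: "finite (set_pmf ?M)" by (rule finite_set_pmf_random_tournament)
  define R where "R = H ` {T \<in> set_pmf ?M. good T}"
  have R: "finite R" "R \<subseteq> G" using fin G by (auto simp: R_def)
  define E where "E = (\<lambda>h. {T. good T \<and> H T = h})"
  have disj: "disjoint_family_on E R"
    by (auto simp: disjoint_family_on_def E_def)
  \<comment> \<open>On each cell \<open>H T = h\<close> the event becomes the fixed event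
    \<open>F h\<close>, and only finitely many cells have positive probability.\<close>
  have "?P {T. good T \<and> T \<in> F (H T)} = ?P (\<Union>h\<in>R. E h \<inter> F h)"
    by (rule measure_prob_cong_0) (auto simp: E_def R_def pmf_eq_0_set_pmf)
  also have "\<dots> = (\<Sum>h\<in>R. ?P (E h \<inter> F h))"
    by (rule measure_pmf.finite_measure_finite_Union)
      (use R disj in \<open>auto simp: disjoint_family_on_def\<close>)
  also have "\<dots> = (\<Sum>h\<in>R. ?P (E h) * ?P (F h))"
  proof (rule sum.cong[OF refl])
    fix h assume "h \<in> R"
    then have "h \<in> G" using R(2) by blast
    then show "?P (E h \<inter> F h) = ?P (E h) * ?P (F h)"
      unfolding E_def using assms(1-3) by (intro prob_determined_independent[of _ "C h" _ "D h"])
  qed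
  also have "\<dots> \<le> (\<Sum>h\<in>R. ?P (E h) * \<epsilon>)"
    using le R(2) by (intro sum_mono mult_left_mono) auto
  also have "\<dots> = ?P (\<Union>h\<in>R. E h) * \<epsilon>"
    unfolding sum_distrib_right[symmetric]
    by (subst measure_pmf.finite_measure_finite_Union) (use R disj in auto)
  also have "\<dots> \<le> 1 * \<epsilon>"
    using \<open>\<epsilon> \<ge> 0\<close> by (intro mult_right_mono) auto
  finally show ?thesis by simp
qed

section \<open>Exponential moments and tail bounds\<close>

lemma expectation_prod_edges_le:
  fixes \<alpha> \<delta> :: real
  assumes p: "model_probabilities n p"
    and \<delta>: "\<And>i j. i < n \<Longrightarrow> j < n \<Longrightarrow> i \<noteq> j \<Longrightarrow> \<delta> \<le> p i j"
    and D: "D \<subseteq> {(i, j). i < n \<and> j < n \<and> i \<noteq> j}" "inj_on pair_key D"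
    and \<alpha>: "0 \<le> \<alpha>" "\<alpha> \<le> 1"
  shows "measure_pmf.expectation (random_tournament n p) (\<lambda>T. \<Prod>e\<in>D. if e \<in> T then \<alpha> else 1)
    \<le> (1 - (1 - \<alpha>) * \<delta>) ^ card D"
proof -
  let ?I = "{(i, j). i < j \<and> j < n}"
  let ?q = "\<lambda>(i, j). bernoulli_pmf (p i j)"
  \<comment> \<open>The factor contributed by coin \<open>k\<close>. The pair of \<open>D\<close>
    behind it may have either orientation, so \<open>\<alpha>\<close> is charged for
    \<open>True\<close> in one case and for \<open>False\<close> in the other; injectivity of
    \<open>pair_key\<close> on \<open>D\<close> excludes having both pairs.\<close>
  define f where "f = (\<lambda>k y. if k \<in> D then (if y then \<alpha> else 1)
    else if prod.swap k \<in> D then (if y then 1 else \<alpha>) else 1)"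
  have K: "pair_key ` D \<subseteq> ?I" using D(1) by (auto simp: pair_key_def)
  have both: False if "(i, j) \<in> D" "(j, i) \<in> D" for i j
  proof -
    have "pair_key (i, j) = pair_key (j, i)" by (simp add: pair_key_def min.commute max.commute)
    then have "i = j" using inj_onD[OF D(2)] that by blast
    then show False using that D(1) by auto
  qed
  have neutral: "f k = (\<lambda>_. 1)" if "k \<in> ?I - pair_key ` D" for k
  proof -
    have "pair_key k = k" "pair_key (prod.swap k) = k" using that by (auto simp: pair_key_def)
    then have "k \<notin> D" "prod.swap k \<notin> D"
      using that imageI[of k D pair_key] imageI[of "prod.swap k" D pair_key] by auto
    then show ?thesis by (simp add: f_def fun_eq_iff)
  qed
  have prod: "(\<Prod>e\<in>D. if e \<in> coin_tournament n c then \<alpha> else 1) = (\<Prod>k\<in>?I. f k (c k))" for c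
  proof -
    have "(\<Prod>k\<in>?I. f k (c k)) = (\<Prod>k\<in>pair_key ` D. f k (c k))"
      by (rule prod.mono_neutral_right[OF finite_coins K]) (simp add: neutral)
    also have "\<dots> = (\<Prod>e\<in>D. f (pair_key e) (c (pair_key e)))"
      by (rule prod.reindex[OF D(2), unfolded o_def])
    also have "\<dots> = (\<Prod>e\<in>D. if e \<in> coin_tournament n c then \<alpha> else 1)"
    proof (rule prod.cong[OF refl])
      fix e assume e: "e \<in> D"
      obtain i j where ij: "e = (i, j)" by (cases e)
      have "i < n" "j < n" "i \<noteq> j" using e D(1) ij by auto
      then show "f (pair_key e) (c (pair_key e)) = (if e \<in> coin_tournament n c then \<alpha> else 1)"
        using e both[of i j] unfolding ij
        by (cases "i < j") (auto simp: f_def pair_key_def coin_tournament_def min_def max_def)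
    qed
    finally show ?thesis by simp
  qed
  have "measure_pmf.expectation (random_tournament n p) (\<lambda>T. \<Prod>e\<in>D. if e \<in> T then \<alpha> else 1)
    = measure_pmf.expectation (coin_pmf n p) (\<lambda>c. \<Prod>k\<in>?I. f k (c k))"
    unfolding random_tournament_coins by (simp add: prod)
  also have "\<dots> = (\<Prod>k\<in>?I. measure_pmf.expectation (?q k) (f k))"
    by (rule expectation_prod_Pi_pmf[OF finite_coins])
      (auto simp: f_def \<alpha> intro!: integrable_measure_pmf_finite)
  also have "\<dots> = (\<Prod>k\<in>pair_key ` D. measure_pmf.expectation (?q k) (f k))"
    by (rule prod.mono_neutral_right[OF finite_coins K]) (simp add: neutral)
  also have "\<dots> \<le> (\<Prod>k\<in>pair_key ` D. 1 - (1 - \<alpha>) * \<delta>)"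
  proof (rule prod_mono, rule conjI)
    fix k assume k: "k \<in> pair_key ` D"
    obtain i j where ij: "k = (i, j)" by (cases k)
    have *: "i < j" "j < n" "i < n" using k K ij by auto
    have pr: "0 \<le> p i j" "p i j \<le> 1" "p i j + p j i = 1" "\<delta> \<le> p i j" "\<delta> \<le> p j i"
      using p * \<delta> by (auto simp: model_probabilities_def)
    have exp: "measure_pmf.expectation (?q k) (f k) = p i j * f k True + (1 - p i j) * f k False"
      using pr by (simp add: ij integral_measure_pmf[of UNIV] UNIV_bool)
    show "0 \<le> measure_pmf.expectation (?q k) (f k)"
      unfolding exp using pr \<alpha> by (auto simp: f_def)
    have "k \<in> D \<or> prod.swap k \<in> D"
      using k by (auto simp: pair_key_def min_def max_def)
    moreover have "(1 - \<alpha>) * \<delta> \<le> (1 - \<alpha>) * p i j" "(1 - \<alpha>) * \<delta> \<le> (1 - \<alpha>) * (1 - p i j)"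
      using pr \<alpha> by (auto intro!: mult_left_mono)
    ultimately show "measure_pmf.expectation (?q k) (f k) \<le> 1 - (1 - \<alpha>) * \<delta>"
      unfolding exp by (auto simp: f_def algebra_simps)
  qed
  also have "\<dots> = (1 - (1 - \<alpha>) * \<delta>) ^ card D"
    by (simp add: card_image[OF D(2)])
  finally show ?thesis .
qed

text \<open>Weight 0 turns the product over \<open>D\<close> into the indicator of the event; then
  \<open>1 - \<delta> \<le> exp (- \<delta>)\<close>.\<close>

lemma prob_no_edges_le:
  fixes \<delta> :: real
  assumes p: "model_probabilities n p"
    and \<delta>: "\<And>i j. i < n \<Longrightarrow> j < n \<Longrightarrow> i \<noteq> j \<Longrightarrow> \<delta> \<le> p i j"
    and D: "D \<subseteq> {(i, j). i < n \<and> j < n \<and> i \<noteq> j}" "inj_on pair_key D" and "\<delta> \<le> 1"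
  shows "measure_pmf.prob (random_tournament n p) {T. T \<inter> D = {}} \<le> exp (- \<delta> * card D)"
proof -
  let ?M = "random_tournament n p"
  have fD: "finite D" by (rule finite_subset[OF D(1)], rule finite_subset[of _ "{..<n} \<times> {..<n}"]) auto
  have "measure_pmf.prob ?M {T. T \<inter> D = {}} = measure_pmf.expectation ?M (indicator {T. T \<inter> D = {}})"
    by simp
  also have "\<dots> = measure_pmf.expectation ?M (\<lambda>T. \<Prod>e\<in>D. if e \<in> T then 0 else 1)"
    using fD
    by (intro Bochner_Integration.integral_cong)
      (auto simp: indicator_def disjoint_iff intro!: prod.neutral)
  also have "\<dots> \<le> (1 - (1 - 0) * \<delta>) ^ card D"
    by (rule expectation_prod_edges_le[OF p \<delta> D]) auto
  also have "\<dots> \<le> exp (- \<delta>) ^ card D"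
    using exp_ge_add_one_self[of "- \<delta>"] \<open>\<delta> \<le> 1\<close> by (intro power_mono) auto
  finally show ?thesis by (simp add: exp_of_nat_mult[symmetric] mult.commute)
qed

text \<open>Markov's inequality for the moment with weight 1/2, which is at least
  \<open>(1 / 2) ^ k\<close> on the event. The crude factor \<open>2 ^ k\<close> is affordable
  because \<open>k\<close> will be logarithmic in \<open>n\<close>.\<close>

lemma prob_few_successors_le:
  fixes \<delta> :: real
  assumes p: "model_probabilities n p"
    and \<delta>: "\<And>i j. i < n \<Longrightarrow> j < n \<Longrightarrow> i \<noteq> j \<Longrightarrow> \<delta> \<le> p i j"
    and U: "U \<subseteq> {..<n} - {v}" "v < n" and "\<delta> \<le> 1"
  shows "measure_pmf.prob (random_tournament n p) {T. card {u \<in> U. (v, u) \<in> T} < k}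
    \<le> 2 ^ k * exp (- \<delta> * card U / 2)"
proof -
  let ?M = "random_tournament n p"
  have fU: "finite U" using U(1) finite_subset by blast
  define D where "D = Pair v ` U"
  have D: "D \<subseteq> {(i, j). i < n \<and> j < n \<and> i \<noteq> j}" "inj_on pair_key D" "card D = card U"
    using U by (auto simp: D_def inj_on_def pair_key_def min_def max_def card_image split: if_splits)
  have prod: "(\<Prod>e\<in>D. if e \<in> T then 1 / 2 else 1 :: real) = (1 / 2) ^ card {u \<in> U. (v, u) \<in> T}" for T
  proof -
    have "(\<Prod>e\<in>D. if e \<in> T then 1 / 2 else 1 :: real) = (\<Prod>u\<in>U. if (v, u) \<in> T then 1 / 2 else 1)"
      unfolding D_def by (subst prod.reindex) (auto simp: inj_on_def)
    also have "\<dots> = (\<Prod>u\<in>{u \<in> U. (v, u) \<in> T}. 1 / 2)"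
      using fU by (subst prod.inter_filter) auto
    finally show ?thesis by simp
  qed
  have int: "integrable ?M (f :: _ \<Rightarrow> real)" for f
    by (rule integrable_measure_pmf_finite[OF finite_set_pmf_random_tournament])
  have "measure_pmf.prob ?M {T. card {u \<in> U. (v, u) \<in> T} < k}
    = measure_pmf.expectation ?M (indicator {T. card {u \<in> U. (v, u) \<in> T} < k})"
    by simp
  also have "\<dots> \<le> measure_pmf.expectation ?M (\<lambda>T. 2 ^ k * (\<Prod>e\<in>D. if e \<in> T then 1 / 2 else 1))"
  proof (rule integral_mono[OF int int])
    fix T
    show "indicator {T. card {u \<in> U. (v, u) \<in> T} < k} T \<le> 2 ^ k * (\<Prod>e\<in>D. if e \<in> T then 1 / 2 else 1 :: real)"
      unfolding prod
      by (auto simp: indicator_def power_one_over divide_simps intro!: power_increasing)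
  qed
  also have "\<dots> = 2 ^ k * measure_pmf.expectation ?M (\<lambda>T. \<Prod>e\<in>D. if e \<in> T then 1 / 2 else 1)"
    by simp
  also have "\<dots> \<le> 2 ^ k * (1 - (1 - 1 / 2) * \<delta>) ^ card D"
    by (intro mult_left_mono expectation_prod_edges_le[OF p \<delta> D(1,2)]) auto
  also have "\<dots> \<le> 2 ^ k * exp (- \<delta> / 2) ^ card D"
    using exp_ge_add_one_self[of "- \<delta> / 2"] \<open>\<delta> \<le> 1\<close> by (intro mult_left_mono power_mono) auto
  finally show ?thesis by (simp add: exp_of_nat_mult[symmetric] D(3) mult.commute)
qed

section \<open>Embedding the binomial tree greedily\<close>

text \<open>
  The binomial tree with \<open>2 ^ M\<close> nodes has root \<open>0\<close>; a node \<open>i\<close> has the children \<open>i + 2 ^ h\<close> for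
  \<open>h < tz M i\<close>. This is the tree of matches in a bracket in which the leftmost leaf of every
  subtree wins that subtree.
\<close>

definition tz :: "nat \<Rightarrow> nat \<Rightarrow> nat" where
  "tz M j = (if j = 0 then M else multiplicity 2 j)"

lemma tz_eqI: "j > 0 \<Longrightarrow> j = 2 ^ h * q \<Longrightarrow> odd q \<Longrightarrow> tz M j = h"
  by (auto simp: tz_def intro!: multiplicity_eqI)

lemma tz_dvd: "i < 2 ^ M \<Longrightarrow> h \<le> tz M i \<Longrightarrow> 2 ^ h dvd i"
  by (auto simp: tz_def multiplicity_dvd' split: if_splits)

lemma tz_le: "j < 2 ^ M \<Longrightarrow> tz M j \<le> M"
proof (cases "j = 0")
  case False
  assume j: "j < 2 ^ M"
  have "2 ^ tz M j \<le> j" using tz_dvd[OF j] False by (auto intro: dvd_imp_le)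
  then have "(2::nat) ^ tz M j < 2 ^ M" using j by linarith
  then show ?thesis by simp
qed (auto simp: tz_def)

lemma tz_ge: "2 ^ h dvd i \<Longrightarrow> h \<le> M \<Longrightarrow> h \<le> tz M i"
  by (auto simp: tz_def intro!: multiplicity_geI)

lemma tz_child:
  assumes "i < 2 ^ M" "h < tz M i"
  shows "i + 2 ^ h < 2 ^ M" "tz M (i + 2 ^ h) = h"
proof -
  have d: "2 ^ Suc h dvd i" using assms tz_dvd[of i M "Suc h"] by simp
  then obtain q where q: "i = 2 ^ Suc h * q" by auto
  show "tz M (i + 2 ^ h) = h"
    by (rule tz_eqI[of _ h "2 * q + 1"]) (auto simp: q algebra_simps)
  have "Suc h \<le> M" using assms tz_le[of i M] by simp
  \<comment> \<open>Both \<open>i\<close> and \<open>2 ^ M\<close> are multiples of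
    \<open>2 ^ Suc h\<close>, so \<open>i < 2 ^ M\<close> leaves a gap of at least
    \<open>2 ^ Suc h\<close>, into which the child fits.\<close>
  then have "(2::nat) ^ M = 2 ^ Suc h * 2 ^ (M - Suc h)"
    by (simp only: power_add[symmetric]) simp
  then have "2 ^ Suc h * q < 2 ^ Suc h * 2 ^ (M - Suc h)" using assms(1) q by simp
  then have "q + 1 \<le> 2 ^ (M - Suc h)" by simp
  then have "2 ^ Suc h * (q + 1) \<le> 2 ^ Suc h * 2 ^ (M - Suc h)" by (rule mult_le_mono2)
  then have "i + 2 ^ Suc h \<le> 2 ^ M" using \<open>2 ^ M = _\<close> q by simp
  moreover have "(2::nat) ^ h < 2 ^ Suc h" by simp
  ultimately show "i + 2 ^ h < 2 ^ M" by linarith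
qed

text \<open>Clearing the lowest set bit of \<open>j\<close> gives its parent, which is divisible by
  a higher power of two.\<close>

lemma tz_parent:
  assumes "0 < j" "j < 2 ^ M"
  shows "2 ^ tz M j \<le> j" "tz M j < tz M (j - 2 ^ tz M j)"
proof -
  define h where "h = tz M j"
  have d: "2 ^ h dvd j" using tz_dvd assms by (simp add: h_def)
  then show "2 ^ tz M j \<le> j" using assms by (simp add: h_def dvd_imp_le)
  obtain q where q: "j = 2 ^ h * q" using d by auto
  have "\<not> 2 ^ Suc h dvd j"
    using assms tz_ge[of "Suc h" j "Suc h"] by (auto simp: h_def tz_def simp del: power_Suc)
  then have "odd q" by (auto simp: q)
  then have "2 ^ Suc h dvd j - 2 ^ h"
    by (auto simp: q elim!: oddE)
  moreover have "Suc h \<le> M"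
  proof -
    have "(2::nat) ^ h < 2 ^ M" using \<open>2 ^ tz M j \<le> j\<close> assms unfolding h_def by linarith
    then show ?thesis by simp
  qed
  ultimately show "tz M j < tz M (j - 2 ^ tz M j)"
    using tz_ge[of "Suc h"] by (simp add: h_def Suc_le_eq)
qed

text \<open>The nodes that have received an alternative once the children of all nodes below \<open>i\<close> are placed.\<close>

definition reached :: "nat \<Rightarrow> nat \<Rightarrow> nat set" where
  "reached M i = {j. j < 2 ^ M \<and> (j = 0 \<or> j - 2 ^ tz M j < i)}"

lemma finite_reached: "finite (reached M i)"
  by (auto simp: reached_def)

lemma card_reached: "card (reached M i) \<le> 2 ^ M"
  using card_mono[of "{..<2 ^ M}" "reached M i"] by (auto simp: reached_def)

lemma reached_0: "reached M 0 = {0}"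
  by (auto simp: reached_def)

lemma reached_mono: "i \<le> i' \<Longrightarrow> reached M i \<subseteq> reached M i'"
  by (auto simp: reached_def)

lemma reached_full: "2 ^ M \<le> i \<Longrightarrow> reached M i = {..<2 ^ M}"
  by (auto simp: reached_def)

text \<open>Parents precede their children in the numbering, so a node carries its alternative by
  the time it is visited.\<close>

lemma self_in_reached: "i < 2 ^ M \<Longrightarrow> i \<in> reached M i"
  using tz_parent[of i M] by (cases "i = 0") (auto simp: reached_def)

lemma child_not_reached: "i < 2 ^ M \<Longrightarrow> h < tz M i \<Longrightarrow> i + 2 ^ h \<notin> reached M i"
  using tz_child[of i M h] by (auto simp: reached_def)

lemma reached_Suc:
  assumes "i < 2 ^ M"
  shows "reached M (Suc i) = reached M i \<union> (\<lambda>h. i + 2 ^ h) ` {..<tz M i}"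
proof
  show "reached M (Suc i) \<subseteq> reached M i \<union> (\<lambda>h. i + 2 ^ h) ` {..<tz M i}"
  proof
    fix j assume j: "j \<in> reached M (Suc i)"
    show "j \<in> reached M i \<union> (\<lambda>h. i + 2 ^ h) ` {..<tz M i}"
    proof (cases "j \<in> reached M i")
      case False
      with j have *: "j > 0" "j < 2 ^ M" "j - 2 ^ tz M j = i" by (auto simp: reached_def)
      then show ?thesis using tz_parent[of j M]
        by (intro UnI2 image_eqI[of _ _ "tz M j"]) auto
    qed auto
  qed
  show "reached M i \<union> (\<lambda>h. i + 2 ^ h) ` {..<tz M i} \<subseteq> reached M (Suc i)"
    using assms tz_child by (auto simp: reached_def)
qed

lemma reached_Suc_odd: "odd i \<or> 2 ^ M \<le> i \<Longrightarrow> reached M (Suc i) = reached M i"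
proof (cases "i < 2 ^ M")
  case True
  assume "odd i \<or> 2 ^ M \<le> i"
  then have "odd i" using True by auto
  then have "tz M i = 0" by (intro tz_eqI[of _ 0 i]) (auto elim: oddE)
  then show ?thesis using reached_Suc[OF True] by simp
qed (simp add: reached_full)

text \<open>
  In an embedding \<open>(b, l, w)\<close>, the node \<open>j\<close> of the tree carries the alternative \<open>b j\<close>, provided that
  \<open>l j \<noteq> 0\<close>; then \<open>l j = 2 ^ tz M j\<close>. The alternatives \<open>u\<close> with \<open>w u = 1\<close> are those in use.
\<close>

type_synonym embedding = "(nat \<Rightarrow> nat) \<times> (nat \<Rightarrow> nat) \<times> (nat \<Rightarrow> nat)"

text \<open>The offset \<open>d\<close> is the power \<open>2 ^ h\<close> for the next child
  \<open>i + 2 ^ h\<close>. It is also that child's \<open>l\<close>-value, and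
  \<open>d < l i\<close> expresses \<open>h < tz M i\<close>, so no exponent is ever
  computed.\<close>

fun child_step :: "nat \<Rightarrow> (nat \<times> nat) set \<Rightarrow> nat \<Rightarrow> nat \<Rightarrow> embedding \<times> nat \<Rightarrow> embedding \<times> nat" where
  "child_step n T i u ((b, l, w), d) =
     (if 16 * u < 9 * n \<and> w u = 0 \<and> (b i, u) \<in> T \<and> d < l i
      then ((b(i + d := u), l(i + d := d), w(u := 1)), d + d) else ((b, l, w), d))"

primrec child_scan :: "nat \<Rightarrow> (nat \<times> nat) set \<Rightarrow> nat \<Rightarrow> nat \<Rightarrow> embedding \<Rightarrow> embedding \<times> nat" where
  "child_scan n T i 0 \<sigma> = (\<sigma>, 1)"
| "child_scan n T i (Suc u) \<sigma> = child_step n T i u (child_scan n T i u \<sigma>)"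

text \<open>The rounds will run up to \<open>n\<close>, as the loops of the program do. Those at odd
  numbers or beyond the last node find \<open>l i \<le> 1\<close> and change nothing.\<close>

primrec greedy :: "nat \<Rightarrow> nat \<Rightarrow> (nat \<times> nat) set \<Rightarrow> nat \<Rightarrow> nat \<Rightarrow> embedding" where
  "greedy M n T x 0 = ((\<lambda>_. 0)(0 := x), (\<lambda>_. 0)(0 := 2 ^ M), (\<lambda>_. 0)(x := 1))"
| "greedy M n T x (Suc i) = fst (child_scan n T i n (greedy M n T x i))"

text \<open>
  The tree has \<open>n / 2\<close> nodes, so at least \<open>n / 16\<close> alternatives of the pool remain unused throughout.
\<close>

definition pool :: "nat \<Rightarrow> nat set" where
  "pool n = {u. 16 * u < 9 * n}"

lemma pool_subset: "pool n \<subseteq> {..<n}"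
  by (auto simp: pool_def)

text \<open>Node \<open>0\<close> is exempt from the pool condition since \<open>x\<close> may be
  any alternative.\<close>

fun embeds :: "nat \<Rightarrow> nat \<Rightarrow> (nat \<times> nat) set \<Rightarrow> nat \<Rightarrow> nat set \<Rightarrow> embedding \<Rightarrow> bool" where
  "embeds M n T x A (b, l, w) \<longleftrightarrow>
     (\<forall>j. l j = (if j \<in> A then 2 ^ tz M j else 0)) \<and> (\<forall>u. w u = (if u \<in> b ` A then 1 else 0)) \<and>
     inj_on b A \<and> b 0 = x \<and> b ` (A - {0}) \<subseteq> pool n \<and>
     (\<forall>j\<in>A - {0}. (b (j - 2 ^ tz M j), b j) \<in> T)"

lemma child_scan_inactive:
  assumes "snd (snd \<sigma>) = w" "fst (snd \<sigma>) i \<le> 1"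
  shows "child_scan n T i k \<sigma> = (\<sigma>, 1)"
  using assms by (induction k) (cases \<sigma>; auto)+

text \<open>The scan reads nothing but the pairs from \<open>fst \<sigma> i\<close> into the pool.
  The other two conjuncts carry the induction: as the offset stays positive, node \<open>i\<close>
  itself is never overwritten.\<close>

lemma child_scan_cong:
  assumes "\<And>u. u \<in> pool n \<Longrightarrow> (fst \<sigma> i, u) \<in> T \<longleftrightarrow> (fst \<sigma> i, u) \<in> T'"
  shows "child_scan n T i k \<sigma> = child_scan n T' i k \<sigma> \<and> fst (fst (child_scan n T i k \<sigma>)) i = fst \<sigma> i \<and>
    snd (child_scan n T i k \<sigma>) > 0"
proof (induction k)
  case (Suc k)
  obtain b l w d where s: "child_scan n T i k \<sigma> = ((b, l, w), d)" by (metis prod.collapse)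
  have "child_scan n T' i k \<sigma> = ((b, l, w), d)" using Suc s by simp
  then show ?case using Suc assms(1)[of k] by (auto simp: s pool_def)
qed auto

text \<open>No eligible candidate is wasted until all children are placed. That \<open>w'\<close>
  agrees with \<open>w\<close> from \<open>k\<close> on lets eligibility be counted in the initial
  \<open>w\<close>, although the scan changes it.\<close>

lemma child_scan_embeds:
  assumes emb: "embeds M n T x A (b, l, w)" and A: "A = reached M i" and i: "i < 2 ^ M"
    and "k \<le> n"
  defines "e \<equiv> min (tz M i) (card {u. u < k \<and> u \<in> pool n \<and> w u = 0 \<and> (b i, u) \<in> T})"
  shows "\<exists>b' l' w'. child_scan n T i k (b, l, w) = ((b', l', w'), 2 ^ e) \<and>
    embeds M n T x (A \<union> (\<lambda>h. i + 2 ^ h) ` {..<e}) (b', l', w') \<and>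
    (\<forall>j\<in>A. b' j = b j) \<and> (\<forall>u\<ge>k. w' u = w u)"
  using \<open>k \<le> n\<close> unfolding e_def
proof (induction k)
  case 0
  then show ?case using emb by auto
next
  case (Suc k)
  define Q where "Q = (\<lambda>k. {u. u < k \<and> u \<in> pool n \<and> w u = 0 \<and> (b i, u) \<in> T})"
  define e where "e = min (tz M i) (card (Q k))"
  define e' where "e' = min (tz M i) (card (Q (Suc k)))"
  define B where "B = A \<union> (\<lambda>h. i + 2 ^ h) ` {..<e}"
  obtain b' l' w' where IH: "child_scan n T i k (b, l, w) = ((b', l', w'), 2 ^ e)"
    "embeds M n T x B (b', l', w')" "\<And>j. j \<in> A \<Longrightarrow> b' j = b j" "\<And>u. u \<ge> k \<Longrightarrow> w' u = w u"
    using Suc by (auto simp: e_def Q_def B_def)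
  have iA: "i \<in> A" using self_in_reached[OF i] A by simp
  have fQ: "finite (Q k)" by (auto simp: Q_def)
  have li: "l' i = 2 ^ tz M i" using IH(2) iA by (auto simp: B_def)
  have bi: "b' i = b i" using IH(3) iA by simp
  have goal: "\<exists>b' l' w'. child_scan n T i (Suc k) (b, l, w) = ((b', l', w'), 2 ^ e') \<and>
    embeds M n T x (A \<union> (\<lambda>h. i + 2 ^ h) ` {..<e'}) (b', l', w') \<and>
    (\<forall>j\<in>A. b' j = b j) \<and> (\<forall>u\<ge>Suc k. w' u = w u)"
  proof (cases "k \<in> pool n \<and> w k = 0 \<and> (b i, k) \<in> T \<and> e < tz M i")
    case True
    have "Q (Suc k) = insert k (Q k)" "k \<notin> Q k" using True by (auto simp: Q_def less_Suc_eq)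
    then have e': "e' = Suc e" using True fQ by (auto simp: e_def e'_def)
    have c: "i + 2 ^ e \<notin> B"
      using child_not_reached[OF i, of e] True by (auto simp: B_def A)
    have c0: "i + 2 ^ e \<noteq> i" "i + 2 ^ e \<noteq> 0" by auto
    have tzc: "tz M (i + 2 ^ e) = e" using tz_child(2)[OF i, of e] True by simp
    have kB: "k \<notin> b' ` B" using IH(2) IH(4)[of k] True by (auto split: if_splits)
    have B': "A \<union> (\<lambda>h. i + 2 ^ h) ` {..<e'} = insert (i + 2 ^ e) B"
      by (auto simp: e' B_def lessThan_Suc)
    \<comment> \<open>The new node is nobody's parent yet, so writing \<open>b'\<close> there does
      not disturb the tree edges already present.\<close>
    have par: "j - 2 ^ tz M j \<noteq> i + 2 ^ e" if "j \<in> B" "j \<noteq> 0" for j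
    proof
      assume *: "j - 2 ^ tz M j = i + 2 ^ e"
      show False
      proof (cases "j \<in> A")
        case True
        then show ?thesis using * that by (auto simp: A reached_def)
      next
        case False
        then obtain h where "h < e" "j = i + 2 ^ h" using \<open>j \<in> B\<close> unfolding B_def by auto
        then show ?thesis using * tz_child(2)[OF i, of h] True by auto
      qed
    qed
    have img: "(b'(i + 2 ^ e := k)) ` insert (i + 2 ^ e) B = insert k (b' ` B)"
      using c by (auto simp: image_iff)
    have "embeds M n T x (insert (i + 2 ^ e) B) (b'(i + 2 ^ e := k), l'(i + 2 ^ e := 2 ^ e), w'(k := 1))"
      unfolding embeds.simps
    proof (intro conjI)
      show "\<forall>u. (w'(k := 1)) u = (if u \<in> (b'(i + 2 ^ e := k)) ` insert (i + 2 ^ e) B then 1 else 0)"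
        unfolding img using IH(2) by auto
      show "inj_on (b'(i + 2 ^ e := k)) (insert (i + 2 ^ e) B)"
        using IH(2) c kB by (auto simp: inj_on_def)
      show "(b'(i + 2 ^ e := k)) ` (insert (i + 2 ^ e) B - {0}) \<subseteq> pool n"
        using IH(2) True by auto
      show "\<forall>j\<in>insert (i + 2 ^ e) B - {0}. ((b'(i + 2 ^ e := k)) (j - 2 ^ tz M j), (b'(i + 2 ^ e := k)) j) \<in> T"
        using IH(2) True par c0 tzc bi by auto
    qed (use IH(2) tzc in auto)
    moreover have "child_scan n T i (Suc k) (b, l, w) =
      ((b'(i + 2 ^ e := k), l'(i + 2 ^ e := 2 ^ e), w'(k := 1)), 2 ^ e')"
      using True li bi IH(4)[of k] by (simp add: IH(1) pool_def e')
    moreover have "\<forall>j\<in>A. (b'(i + 2 ^ e := k)) j = b j"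
      using IH(3) c by (auto simp: B_def)
    ultimately show ?thesis using IH(4) B' by auto
  next
    case False
    have e': "e' = e"
    proof (cases "k \<in> pool n \<and> w k = 0 \<and> (b i, k) \<in> T")
      case True
      then have "tz M i \<le> card (Q k)" using False by (auto simp: e_def)
      moreover have "card (Q k) \<le> card (Q (Suc k))"
        by (rule card_mono) (auto simp: Q_def)
      ultimately show ?thesis by (simp add: e_def e'_def)
    next
      case False
      then have "Q (Suc k) = Q k" by (auto simp: Q_def less_Suc_eq)
      then show ?thesis by (simp add: e_def e'_def)
    qed
    have "child_scan n T i (Suc k) (b, l, w) = ((b', l', w'), 2 ^ e)"
      using False li bi IH(4)[of k] by (auto simp: IH(1) pool_def)
    then show ?thesis using IH(2-4) by (auto simp: e' B_def)
  qed
  then show ?case by (simp add: e'_def Q_def)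
qed

definition unused_successors :: "nat \<Rightarrow> (nat \<times> nat) set \<Rightarrow> embedding \<Rightarrow> nat \<Rightarrow> nat set" where
  "unused_successors n T \<sigma> i = {u \<in> {u \<in> pool n. snd (snd \<sigma>) u = 0}. (fst \<sigma> i, u) \<in> T}"

text \<open>Asking for \<open>M\<close> successors at each even node, whatever \<open>tz M k\<close>
  is, gives failures of a single shape.\<close>

definition greedy_succeeds :: "nat \<Rightarrow> nat \<Rightarrow> (nat \<times> nat) set \<Rightarrow> nat \<Rightarrow> nat \<Rightarrow> bool" where
  "greedy_succeeds M n T x i \<longleftrightarrow>
     (\<forall>k<i. even k \<and> k < 2 ^ M \<longrightarrow> M \<le> card (unused_successors n T (greedy M n T x k) k))"

lemma greedy_step:
  assumes emb: "embeds M n T x (reached M i) (greedy M n T x i)"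
    and ok: "even i \<and> i < 2 ^ M \<longrightarrow> M \<le> card (unused_successors n T (greedy M n T x i) i)"
  shows "embeds M n T x (reached M (Suc i)) (greedy M n T x (Suc i)) \<and>
    (\<forall>j\<in>reached M i. fst (greedy M n T x (Suc i)) j = fst (greedy M n T x i) j) \<and>
    (odd i \<or> 2 ^ M \<le> i \<longrightarrow> greedy M n T x (Suc i) = greedy M n T x i)"
proof (cases "even i \<and> i < 2 ^ M")
  case True
  obtain b l w where s: "greedy M n T x i = (b, l, w)" by (metis prod.collapse)
  have U: "unused_successors n T (greedy M n T x i) i = {u. u < n \<and> u \<in> pool n \<and> w u = 0 \<and> (b i, u) \<in> T}"
    using pool_subset[of n] by (auto simp: unused_successors_def s)
  have tz: "min (tz M i) (card {u. u < n \<and> u \<in> pool n \<and> w u = 0 \<and> (b i, u) \<in> T}) = tz M i"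
    using ok True tz_le[of i M] unfolding U by simp
  have "i < 2 ^ M" using True by simp
  then show ?thesis
    using child_scan_embeds[OF emb[unfolded s] refl, of n, unfolded tz] reached_Suc[of i M] True
    by (auto simp: s)
next
  case False
  obtain b l w where s: "greedy M n T x i = (b, l, w)" by (metis prod.collapse)
  have "l i \<le> 1"
  proof (cases "i < 2 ^ M")
    case True
    then have "tz M i = 0" using False by (intro tz_eqI[of _ 0 i]) (auto elim: oddE)
    then show ?thesis using emb by (auto simp: s)
  next
    case False
    then show ?thesis using emb by (auto simp: s reached_def)
  qed
  then have "greedy M n T x (Suc i) = greedy M n T x i"
    by (simp add: s child_scan_inactive)
  then show ?thesis using emb reached_Suc_odd[of i M] False by auto
qed

lemma greedy_embeds:
  "greedy_succeeds M n T x i \<Longrightarrow> embeds M n T x (reached M i) (greedy M n T x i)"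
proof (induction i)
  case 0
  show ?case by (auto simp: reached_0 tz_def)
next
  case (Suc i)
  then have "greedy_succeeds M n T x i" by (auto simp: greedy_succeeds_def)
  then show ?case using greedy_step[of M n T x i] Suc by (auto simp: greedy_succeeds_def)
qed

text \<open>Placed nodes keep their alternatives, so \<open>exposed\<close>, computed from a later
  embedding, still lists the pairs read in earlier rounds.\<close>

lemma greedy_stable:
  assumes "greedy_succeeds M n T x i" "k \<le> i" "j \<in> reached M k"
  shows "fst (greedy M n T x i) j = fst (greedy M n T x k) j"
  using assms(2,1)
proof (induction i rule: dec_induct)
  case (step i)
  have "greedy_succeeds M n T x i" using step.prems by (auto simp: greedy_succeeds_def)
  moreover from this have "fst (greedy M n T x (Suc i)) j = fst (greedy M n T x i) j"
    using greedy_step[OF greedy_embeds, of M n T x i] step.prems reached_mono[OF step.hyps(1)] assms(3)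
    by (auto simp: greedy_succeeds_def)
  ultimately show ?case using step.IH by simp
qed simp

text \<open>
  The pairs inspected before step \<open>i\<close>. Odd nodes have no children, so their alternatives inspect
  nothing; this keeps enough pairs unexposed for the matching phase.
\<close>

definition exposed :: "nat \<Rightarrow> nat \<Rightarrow> nat \<Rightarrow> embedding \<Rightarrow> (nat \<times> nat) set" where
  "exposed M n i \<sigma> = {(fst \<sigma> k, u) | k u. k < i \<and> even k \<and> k < 2 ^ M \<and> u \<in> pool n}"

text \<open>Which pairs are read depends on the tournament, but the run can be replayed: a
  tournament that agrees on the pairs read so far makes the next round read the same pairs and find
  the same answers. \<open>prob_adaptive_le\<close> needs this for its \<open>H\<close>.\<close>

lemma greedy_determined:
  assumes "greedy_succeeds M n T x i"
    and "T \<inter> exposed M n i (greedy M n T x i) = T' \<inter> exposed M n i (greedy M n T x i)"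
  shows "greedy_succeeds M n T' x i \<and> greedy M n T' x i = greedy M n T x i"
  using assms
proof (induction i)
  case 0
  then show ?case by (simp add: greedy_succeeds_def)
next
  case (Suc i)
  have ok: "greedy_succeeds M n T x i" using Suc.prems by (auto simp: greedy_succeeds_def)
  have st: "fst (greedy M n T x (Suc i)) k = fst (greedy M n T x i) k" if "k < Suc i" "k < 2 ^ M" for k
    using that Suc.prems(1) self_in_reached[of k M] reached_mono[of k i M]
    by (intro greedy_stable) auto
  have "exposed M n i (greedy M n T x i) \<subseteq> exposed M n (Suc i) (greedy M n T x (Suc i))"
    unfolding exposed_def using st by (auto; metis less_SucI)
  then have IH: "greedy_succeeds M n T' x i" "greedy M n T' x i = greedy M n T x i"
    using Suc.IH[OF ok] Suc.prems(2) by blast+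
  show ?case
  proof (cases "even i \<and> i < 2 ^ M")
    case True
    have read: "(fst (greedy M n T x i) i, u) \<in> T \<longleftrightarrow> (fst (greedy M n T x i) i, u) \<in> T'" if "u \<in> pool n" for u
    proof -
      have "(fst (greedy M n T x (Suc i)) i, u) \<in> exposed M n (Suc i) (greedy M n T x (Suc i))"
        unfolding exposed_def using True that by blast
      then show ?thesis using Suc.prems(2) st[of i] True by auto
    qed
    then have U: "unused_successors n T' (greedy M n T x i) i = unused_successors n T (greedy M n T x i) i"
      by (auto simp: unused_successors_def)
    have "greedy M n T' x (Suc i) = greedy M n T x (Suc i)"
      using child_scan_cong[of n "greedy M n T x i" i T T' n] read by (simp add: IH(2))
    moreover have "greedy_succeeds M n T' x (Suc i)"
      using IH U Suc.prems(1) by (auto simp: greedy_succeeds_def less_Suc_eq)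
    ultimately show ?thesis by blast
  next
    case False
    have "greedy_succeeds M n T' x (Suc i)"
      using IH(1) False by (auto simp: greedy_succeeds_def less_Suc_eq)
    moreover have "greedy M n T' x (Suc i) = greedy M n T' x i" "greedy M n T x (Suc i) = greedy M n T x i"
      using greedy_step[OF greedy_embeds[OF IH(1)]] greedy_step[OF greedy_embeds[OF ok]] False by auto
    ultimately show ?thesis using IH(2) by simp
  qed
qed

section \<open>Bipartite matching by auction\<close>

text \<open>
  Bidders are \<open>1, \<dots>, m\<close>, and \<open>own y = 0\<close> means that the item \<open>y\<close> is free. The current bidder \<open>c\<close>
  (\<open>0\<close> if there is none) takes a cheapest item \<open>y\<close> of \<open>N c\<close>, whose price \<open>lab y\<close> then increases by
  one and whose previous owner, if any, bids next.
\<close>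

definition auction_inv ::
  "(nat \<Rightarrow> nat set) \<Rightarrow> nat \<Rightarrow> (nat \<Rightarrow> nat) \<Rightarrow> (nat \<Rightarrow> nat) \<Rightarrow> nat \<Rightarrow> bool" where
  "auction_inv N k own lab c \<longleftrightarrow>
     (\<forall>y. own y \<noteq> 0 \<longrightarrow> y \<in> N (own y)) \<and> inj_on own {y. own y \<noteq> 0} \<and>
     (c \<noteq> 0 \<longrightarrow> c \<notin> range own) \<and> (range own \<union> {c}) - {0} = {1..k} \<and>
     (\<forall>y. lab y \<noteq> 0 \<longrightarrow> own y \<noteq> 0) \<and>
     (\<forall>y. own y \<noteq> 0 \<longrightarrow> (\<forall>y'\<in>N (own y). lab y \<le> lab y' + 1))"

definition hall :: "(nat \<Rightarrow> nat set) \<Rightarrow> nat \<Rightarrow> bool" where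
  "hall N m \<longleftrightarrow> (\<forall>X\<subseteq>{1..m}. card X \<le> card (\<Union>(N ` X)))"

text \<open>
  The owners of the items of price above \<open>j\<close>, together with \<open>c\<close>, only want items of price at least
  \<open>j\<close>; so by Hall's condition the number of items of price at least \<open>j\<close> strictly decreases in \<open>j\<close>.
\<close>

lemma auction_label_less:
  assumes inv: "auction_inv N k own lab c" and "c \<noteq> 0" "k \<le> m"
    and hall: "hall N m" and N: "\<And>i. i \<in> {1..m} \<Longrightarrow> N i \<subseteq> Y" "finite Y" "card Y = m"
    and min: "\<And>y. y \<in> N c \<Longrightarrow> q \<le> lab y"
  shows "q < m"
proof -
  have inj: "inj_on own {z. own z \<noteq> 0}" and c: "c \<notin> range own"
    and ran: "(range own \<union> {c}) - {0} = {1..k}" and lab: "\<And>z. lab z \<noteq> 0 \<Longrightarrow> own z \<noteq> 0"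
    and le: "\<And>z y'. own z \<noteq> 0 \<Longrightarrow> y' \<in> N (own z) \<Longrightarrow> lab z \<le> lab y' + 1"
    using inv \<open>c \<noteq> 0\<close> unfolding auction_inv_def by blast+
  have owned: "own z \<noteq> 0" if "Suc j \<le> lab z" for j z
    using lab[of z] that by simp
  have step: "card {y \<in> Y. Suc j \<le> lab y} + 1 \<le> card {y \<in> Y. j \<le> lab y}" if "j \<le> q" for j
  proof -
    define X where "X = insert c (own ` {y \<in> Y. Suc j \<le> lab y})"
    have "inj_on own {y \<in> Y. Suc j \<le> lab y}"
      by (rule inj_on_subset[OF inj]) (use owned[of j] in blast)
    moreover have "c \<notin> own ` {y \<in> Y. Suc j \<le> lab y}"
      using c by blast
    ultimately have "card X = card {y \<in> Y. Suc j \<le> lab y} + 1"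
      using N(2) unfolding X_def by (subst card_insert_disjoint) (auto simp: card_image)
    moreover have X: "X \<subseteq> {1..m}"
    proof -
      have "X \<subseteq> (range own \<union> {c}) - {0}"
        using \<open>c \<noteq> 0\<close> by (auto simp: X_def simp del: Suc_le_eq dest: owned)
      then show ?thesis unfolding ran using \<open>k \<le> m\<close> by auto
    qed
    moreover have "\<Union>(N ` X) \<subseteq> {y \<in> Y. j \<le> lab y}"
    proof (intro UN_least subsetI)
      fix i y assume i: "i \<in> X" "y \<in> N i"
      have "y \<in> Y" using X N(1) i by blast
      moreover have "j \<le> lab y"
      proof (cases "i = c")
        case True
        then show ?thesis using min[of y] i that by simp
      next
        case False
        then obtain z where "i = own z" "Suc j \<le> lab z" using i(1) by (auto simp: X_def)
        moreover from this have "lab z \<le> lab y + 1"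
          using le[of z y] owned[of j z] i(2) by simp
        ultimately show ?thesis by simp
      qed
      ultimately show "y \<in> {y \<in> Y. j \<le> lab y}" by simp
    qed
    then have "card (\<Union>(N ` X)) \<le> card {y \<in> Y. j \<le> lab y}"
      using N(2) by (intro card_mono) auto
    moreover have "card X \<le> card (\<Union>(N ` X))"
      using hall X unfolding hall_def by blast
    ultimately show ?thesis by linarith
  qed
  have "card {y \<in> Y. j \<le> lab y} + j \<le> m" if "j \<le> Suc q" for j
    using that
  proof (induction j)
    case (Suc j)
    then show ?case using step[of j] by simp
  qed (use N(3) in simp)
  from this[of "Suc q"] show ?thesis by simp
qed

lemma hall_nonempty: "hall N m \<Longrightarrow> c \<in> {1..m} \<Longrightarrow> N c \<noteq> {}"
  unfolding hall_def by (drule spec[of _ "{c}"]) auto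

text \<open>The last clause of \<open>auction_inv\<close> is complementary slackness up to one unit.
  It survives because the bidder takes a cheapest item, while for the other owners the items they
  want can only become dearer. Priced items stay owned, as they are only handed over.\<close>

lemma auction_step:
  assumes inv: "auction_inv N k own lab c" and "c \<noteq> 0"
    and y: "y \<in> N c" "\<And>y'. y' \<in> N c \<Longrightarrow> lab y \<le> lab y'"
  shows "auction_inv N k (own(y := c)) (lab(y := Suc (lab y))) (own y)"
proof -
  have inj: "inj_on own {z. own z \<noteq> 0}" and c: "c \<notin> range own"
    and ran: "(range own \<union> {c}) - {0} = {1..k}" and lab: "\<And>z. lab z \<noteq> 0 \<Longrightarrow> own z \<noteq> 0"
    and le: "\<And>z y'. own z \<noteq> 0 \<Longrightarrow> y' \<in> N (own z) \<Longrightarrow> lab z \<le> lab y' + 1"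
    and nb: "\<And>z. own z \<noteq> 0 \<Longrightarrow> z \<in> N (own z)"
    using inv \<open>c \<noteq> 0\<close> unfolding auction_inv_def by blast+
  have "range (own(y := c)) \<union> {own y} = range own \<union> {c}"
    by (auto simp: image_iff)
  moreover have "own y \<notin> range (own(y := c))" if "own y \<noteq> 0"
    using that inj c by (auto simp: inj_on_def image_iff fun_upd_def split: if_splits)
  moreover have "inj_on (own(y := c)) {z. (own(y := c)) z \<noteq> 0}"
    using inj c by (auto simp: inj_on_def)
  moreover have "(lab(y := Suc (lab y))) z \<le> (lab(y := Suc (lab y))) y' + 1"
    if "(own(y := c)) z \<noteq> 0" "y' \<in> N ((own(y := c)) z)" for z y'
    using that y(2)[of y'] le[of z y'] by (auto split: if_splits)
  ultimately show ?thesis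
    unfolding auction_inv_def using ran lab nb y(1) \<open>c \<noteq> 0\<close> by (auto split: if_splits)
qed

lemma auction_start:
  assumes "auction_inv N k own lab 0"
  shows "auction_inv N (Suc k) own lab (Suc k)"
proof -
  have ran: "range own - {0} = {1..k}" using assms by (simp add: auction_inv_def)
  then have "Suc k \<notin> range own" by (metis Diff_iff Suc_n_not_le_n atLeastAtMost_iff nat.distinct(1) singletonD)
  moreover have "(range own \<union> {Suc k}) - {0} = {1..Suc k}"
    using ran by (auto simp: atLeastAtMostSuc_conv)
  ultimately show ?thesis using assms by (simp add: auction_inv_def)
qed

section \<open>The program\<close>

lemma wins_underI:
  assumes bij: "bij_betw bf {..<2 ^ r} V"
    and dom: "\<And>h j. 2 ^ Suc h dvd j \<Longrightarrow> j + 2 ^ h < 2 ^ r \<Longrightarrow> (bf j, bf (j + 2 ^ h)) \<in> T"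
  shows "wins_under V T r bf (bf 0)"
proof -
  \<comment> \<open>The leftmost leaf wins each subtree: sibling subtrees of height \<open>h\<close>
    have leftmost leaves at distance \<open>2 ^ h\<close>, and \<open>dom\<close> covers exactly
    this match.\<close>
  have "subtree_winner T bf h k = bf (k * 2 ^ h)" if "h \<le> r" "k < 2 ^ (r - h)" for h k
    using that
  proof (induction h arbitrary: k)
    case (Suc h)
    have e: "(2::nat) ^ (r - h) = 2 * 2 ^ (r - Suc h)"
      using Suc.prems(1) by (simp flip: power_Suc add: Suc_diff_Suc)
    then have k: "2 * k < 2 ^ (r - h)" "2 * k + 1 < 2 ^ (r - h)" using Suc.prems(2) by auto
    have "(2 * k + 1) * 2 ^ h < 2 ^ (r - h) * 2 ^ h" by (rule mult_strict_right_mono[OF k(2)]) simp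
    also have "\<dots> = (2::nat) ^ r" using Suc.prems(1) by (simp flip: power_add)
    finally have "(bf (k * 2 ^ Suc h), bf (k * 2 ^ Suc h + 2 ^ h)) \<in> T"
      by (intro dom) (auto simp: algebra_simps)
    then show ?case using Suc.IH[OF _ k(1)] Suc.IH[OF _ k(2)] Suc.prems(1)
      by (simp add: Let_def algebra_simps)
  qed auto
  from this[of r 0] show ?thesis using bij by (simp add: wins_under_def is_bracket_def)
qed

text \<open>Bidder \<open>c\<close> stands for node \<open>c - 1\<close>, as \<open>0\<close> is
  reserved for the absence of a bidder.\<close>

definition wants :: "nat \<Rightarrow> (nat \<times> nat) set \<Rightarrow> embedding \<Rightarrow> nat \<Rightarrow> nat set" where
  "wants n T \<sigma> c = {y. y < n \<and> snd (snd \<sigma>) y = 0 \<and> (fst \<sigma> (c - 1), y) \<in> T}"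

text \<open>Tree nodes sit on the even leaves, and the partner of node \<open>i\<close> on leaf
  \<open>2 * i + 1\<close>. The matching decides the first round; what remains is a bracket of half
  the size whose matches are the tree edges.\<close>

lemma wins_under_from_matching:
  assumes emb: "embeds M (2 ^ Suc M) T x {..<2 ^ M} \<sigma>" and x: "x < 2 ^ Suc M"
    and inv: "auction_inv (wants (2 ^ Suc M) T \<sigma>) (2 ^ M) own lab 0"
    and even: "\<And>i. bf (2 * i) = fst \<sigma> i" and odd: "\<And>y. own y \<noteq> 0 \<Longrightarrow> bf (2 * own y - 1) = y"
  shows "wins_under {..<2 ^ Suc M} T (Suc M) bf x"
proof -
  obtain b l w where s: "\<sigma> = (b, l, w)" by (metis prod.collapse)
  have E: "embeds M (2 ^ Suc M) T x {..<2 ^ M} (b, l, w)" using emb s by simp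
  have inj: "inj_on b {..<2 ^ M}" and b0: "b 0 = x"
    and w: "\<forall>u. w u = (if u \<in> b ` {..<2 ^ M} then 1 else 0)"
    and pool: "b ` ({..<2 ^ M} - {0}) \<subseteq> pool (2 ^ Suc M)"
    and par: "\<forall>j\<in>{..<2 ^ M} - {0}. (b (j - 2 ^ tz M j), b j) \<in> T"
    using E unfolding embeds.simps by - (elim conjE, assumption)+
  have ev: "bf (2 * i) = b i" for i using even by (simp add: s)
  have matched: "own (bf (2 * i + 1)) = Suc i" "bf (2 * i + 1) < 2 ^ Suc M"
      "bf (2 * i + 1) \<notin> b ` {..<2 ^ M}" "(b i, bf (2 * i + 1)) \<in> T"
    if "i < 2 ^ M" for i
  proof -
    have "Suc i \<in> (range own \<union> {0}) - {0}"
      using inv that unfolding auction_inv_def by (simp only:) auto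
    then obtain y where y: "own y = Suc i" by auto
    then have "y \<in> wants (2 ^ Suc M) T \<sigma> (Suc i)" using inv unfolding auction_inv_def by (metis nat.distinct(1))
    moreover have "bf (2 * i + 1) = y" using odd[of y] y by simp
    ultimately show "own (bf (2 * i + 1)) = Suc i" "bf (2 * i + 1) < 2 ^ Suc M"
      "bf (2 * i + 1) \<notin> b ` {..<2 ^ M}" "(b i, bf (2 * i + 1)) \<in> T"
      using y w by (auto simp: wants_def s split: if_splits)
  qed
  have split: "(\<exists>i<2 ^ M. j = 2 * i) \<or> (\<exists>i<2 ^ M. j = 2 * i + 1)" if "j < 2 ^ Suc M" for j :: nat
    using that by (cases "even j") (auto elim!: evenE oddE)
  have b_n: "b i < 2 ^ Suc M" if "i < 2 ^ M" for i
    using that pool b0 x pool_subset[of "2 ^ Suc M"] by (cases "i = 0") auto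
  have "bij_betw bf {..<2 ^ Suc M} {..<2 ^ Suc M}"
  proof -
    have "inj_on bf {..<2 ^ Suc M}"
    proof (rule inj_onI)
      fix j k assume jk: "j \<in> {..<2 ^ Suc M}" "k \<in> {..<2 ^ Suc M}" "bf j = bf k"
      have "j < 2 ^ Suc M" "k < 2 ^ Suc M" using jk by auto
      from split[OF this(1)] split[OF this(2)] show "j = k"
      proof (elim disjE exE conjE)
        fix i i' assume "i < 2 ^ M" "j = 2 * i" "i' < 2 ^ M" "k = 2 * i'"
        then show ?thesis using inj jk(3) by (auto simp: ev inj_on_def)
      next
        fix i i' assume "i < 2 ^ M" "j = 2 * i" "i' < 2 ^ M" "k = 2 * i' + 1"
        then show ?thesis using matched(3)[of i'] jk(3) imageI[of i "{..<2 ^ M}" b] by (simp add: ev)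
      next
        fix i i' assume "i < 2 ^ M" "j = 2 * i + 1" "i' < 2 ^ M" "k = 2 * i'"
        then show ?thesis using matched(3)[of i] jk(3) imageI[of i' "{..<2 ^ M}" b] by (simp add: ev)
      next
        fix i i' assume *: "i < 2 ^ M" "j = 2 * i + 1" "i' < 2 ^ M" "k = 2 * i' + 1"
        have "Suc i = own (bf j)" "Suc i' = own (bf k)"
          using matched(1)[OF *(1)] matched(1)[OF *(3)] *(2,4) by (simp_all only:)
        then have "i = i'" using jk(3) by (metis Suc_inject)
        then show ?thesis using * by simp
      qed
    qed
    moreover have "bf ` {..<2 ^ Suc M} \<subseteq> {..<2 ^ Suc M}"
    proof
      fix y assume "y \<in> bf ` {..<2 ^ Suc M}"
      then obtain j where "j < 2 ^ Suc M" "y = bf j" by auto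
      from split[OF this(1)] this(2) show "y \<in> {..<2 ^ Suc M}"
        using matched(2) b_n by (auto simp: ev)
    qed
    ultimately show ?thesis
      by (simp add: bij_betw_def endo_inj_surj)
  qed
  moreover have "(bf j, bf (j + 2 ^ h)) \<in> T" if dvd: "2 ^ Suc h dvd j" and lt: "j + 2 ^ h < 2 ^ Suc M" for h j
  proof (cases h)
    case 0
    then have "even j" using dvd by simp
    then obtain i where i: "j = 2 * i" by (rule evenE)
    then have "i < 2 ^ M" using lt by simp
    from matched(4)[OF this] show ?thesis by (simp add: i 0 ev)
  next
    case (Suc h')
    \<comment> \<open>Beyond the first round, leaf \<open>2 * i\<close> stands for node
      \<open>i\<close>, and leaves at distance \<open>2 ^ Suc h'\<close> become a node and its child
      \<open>i + 2 ^ h'\<close>.\<close>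
    obtain q where q: "j = 2 ^ Suc h * q" using dvd by (rule dvdE)
    define i where "i = 2 ^ Suc h' * q"
    have j: "j = 2 * i" "j + 2 ^ h = 2 * (i + 2 ^ h')" by (simp_all add: q i_def Suc)
    have "tz M (i + 2 ^ h') = h'"
      by (rule tz_eqI[of _ h' "2 * q + 1"]) (auto simp: i_def algebra_simps)
    moreover have "i + 2 ^ h' < 2 ^ M" using lt unfolding j(2) by simp
    ultimately have "(b i, b (i + 2 ^ h')) \<in> T" using bspec[OF par, of "i + 2 ^ h'"] by simp
    then show ?thesis by (metis j ev)
  qed
  ultimately have "wins_under {..<2 ^ Suc M} T (Suc M) bf (bf 0)" by (rule wins_underI)
  then show ?thesis using ev[of 0] b0 by simp
qed

section \<open>Text of the bracket program\<close>

primrec Times :: "nat \<Rightarrow> expr \<Rightarrow> expr" where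
  "Times 0 e = Num 0"
| "Times (Suc k) e = Add e (Times k e)"

lemma expr_val_Times: "expr_val s (Times k e) = k * expr_val s e"
  by (induction k) auto

abbreviation assign :: "string \<Rightarrow> expr \<Rightarrow> for_prog" where
  "assign v e \<equiv> FWrite v (Num 0) (Num 0) e"

abbreviation Row :: "string \<Rightarrow> expr \<Rightarrow> expr" where
  "Row a e \<equiv> Cell a (Var ''x'') e"

abbreviation row_assign :: "string \<Rightarrow> expr \<Rightarrow> expr \<Rightarrow> for_prog" where
  "row_assign a e g \<equiv> FWrite a (Var ''x'') e g"

text \<open>The loop finds \<open>n / 2\<close>, the \<open>low\<close> value of the root, without
  division: for even \<open>n\<close>, the last \<open>u\<close> with \<open>2 * u < n\<close> is
  \<open>n / 2 - 1\<close>.\<close>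

definition init_prog :: for_prog where
  "init_prog =
    FSeq (row_assign ''used'' (Var ''x'') (Num 1))
   (FSeq (row_assign ''bracket'' (Num 0) (Var ''x''))
   (FFor ''u'' (FCond (Sub (Var ''n'') (Times 2 (Var ''u'')))
      (row_assign ''low'' (Num 0) (Add (Var ''u'') (Num 1))) FSkip)))"

definition child_prog :: for_prog where
  "child_prog =
    FCond (Sub (Times 9 (Var ''n'')) (Times 16 (Var ''u'')))
      (FCond (Row ''used'' (Var ''u'')) FSkip
        (FCond (Cell ''dominates'' (Row ''bracket'' (Times 2 (Var ''i''))) (Var ''u''))
          (FCond (Sub (Row ''low'' (Var ''i'')) (Var ''d''))
            (FSeq (row_assign ''bracket'' (Times 2 (Add (Var ''i'') (Var ''d''))) (Var ''u''))
            (FSeq (row_assign ''low'' (Add (Var ''i'') (Var ''d'')) (Var ''d''))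
            (FSeq (row_assign ''used'' (Var ''u'') (Num 1))
                  (assign ''d'' (Times 2 (Var ''d''))))))
            FSkip)
          FSkip))
      FSkip"

definition greedy_prog :: for_prog where
  "greedy_prog = FFor ''i'' (FSeq (assign ''d'' (Num 1)) (FFor ''u'' child_prog))"

text \<open>\<open>best\<close> is the chosen item plus one, so \<open>0\<close> means that none has
  been found.\<close>

definition cheapest_prog :: for_prog where
  "cheapest_prog =
    FFor ''y'' (FCond (Row ''used'' (Var ''y'')) FSkip
      (FCond (Cell ''dominates'' (Row ''bracket'' (Times 2 (Sub (Var ''c'') (Num 1)))) (Var ''y''))
        (FCond (Var ''best'')
          (FCond (Sub (Row ''lab'' (Sub (Var ''best'') (Num 1))) (Row ''lab'' (Var ''y'')))
            (assign ''best'' (Add (Var ''y'') (Num 1))) FSkip)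
          (assign ''best'' (Add (Var ''y'') (Num 1))))
        FSkip))"

definition take_prog :: for_prog where
  "take_prog =
    FSeq (assign ''tmp'' (Row ''own'' (Sub (Var ''best'') (Num 1))))
   (FSeq (row_assign ''own'' (Sub (Var ''best'') (Num 1)) (Var ''c''))
   (FSeq (row_assign ''lab'' (Sub (Var ''best'') (Num 1))
            (Add (Row ''lab'' (Sub (Var ''best'') (Num 1))) (Num 1)))
         (assign ''c'' (Var ''tmp''))))"

definition bid_prog :: for_prog where
  "bid_prog =
    FCond (Var ''c'')
      (FSeq (assign ''best'' (Num 0))
      (FSeq cheapest_prog (FCond (Var ''best'') take_prog FSkip)))
      FSkip"

text \<open>Each of the \<open>n / 2\<close> bidders triggers \<open>n * n\<close> bids. Under
  Hall's condition no price exceeds \<open>n / 2\<close>, so this is more than the prices can ever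
  add up to; bids left over after the auction has settled are idle.\<close>

definition auction_prog :: for_prog where
  "auction_prog =
    FFor ''i'' (FCond (Sub (Var ''n'') (Times 2 (Var ''i'')))
      (FSeq (assign ''c'' (Add (Var ''i'') (Num 1))) (FFor ''p'' (FFor ''q'' bid_prog)))
      FSkip)"

text \<open>Leaf \<open>2 * own - 1\<close> is the neighbour \<open>2 * i + 1\<close> of node
  \<open>i = own - 1\<close>; the even leaves were filled while the tree was built.\<close>

definition output_prog :: for_prog where
  "output_prog =
    FFor ''y'' (FCond (Row ''own'' (Var ''y''))
      (row_assign ''bracket'' (Sub (Times 2 (Row ''own'' (Var ''y''))) (Num 1)) (Var ''y''))
      FSkip)"

definition bracket_prog :: for_prog where
  "bracket_prog =
    FFor ''x'' (FSeq init_prog (FSeq greedy_prog (FSeq auction_prog output_prog)))"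

lemmas prog_defs = init_prog_def child_prog_def greedy_prog_def cheapest_prog_def take_prog_def
  bid_prog_def auction_prog_def output_prog_def bracket_prog_def

lemma wf_bracket_prog: "wf_for bracket_prog"
  by (simp add: prog_defs)

section \<open>Correctness of the program on solvable tournaments\<close>

definition ctx :: "nat \<Rightarrow> (nat \<times> nat) set \<Rightarrow> nat \<Rightarrow> store \<Rightarrow> bool" where
  "ctx n T x s \<longleftrightarrow> s (''n'', 0, 0) = n \<and> s (''x'', 0, 0) = x \<and>
     (\<forall>i j. s (''dominates'', i, j) = (if (i, j) \<in> T then 1 else 0))"

lemma ctx_sem:
  "ctx n T x s \<Longrightarrow> {''n'', ''x'', ''dominates''} \<inter> written c = {} \<Longrightarrow> ctx n T x (sem c s)"
  by (simp add: ctx_def sem_unwritten)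

lemma ctx_upd:
  "ctx n T x s \<Longrightarrow> a \<notin> {''n'', ''x'', ''dominates''} \<Longrightarrow> ctx n T x (s((a, k) := z))"
  by (cases k) (auto simp: ctx_def)

definition stored_embedding :: "nat \<Rightarrow> store \<Rightarrow> embedding" where
  "stored_embedding x s =
     ((\<lambda>i. s (''bracket'', x, 2 * i)), (\<lambda>i. s (''low'', x, i)), (\<lambda>u. s (''used'', x, u)))"

lemma stored_embedding_cong:
  "(\<And>a i. a \<in> {''bracket'', ''low'', ''used''} \<Longrightarrow> s (a, x, i) = s' (a, x, i)) \<Longrightarrow>
    stored_embedding x s = stored_embedding x s'"
  by (simp add: stored_embedding_def)

lemma sem_init_prog:
  assumes ctx: "ctx (2 ^ Suc M) T x s"
    and zero: "\<And>a i. a \<in> {''bracket'', ''low'', ''used''} \<Longrightarrow> s (a, x, i) = 0"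
  shows "stored_embedding x (sem init_prog s) = greedy M (2 ^ Suc M) T x 0"
proof -
  let ?c = "FCond (Sub (Var ''n'') (Times 2 (Var ''u''))) (row_assign ''low'' (Num 0) (Add (Var ''u'') (Num 1))) FSkip"
  let ?n = "2 ^ Suc M :: nat"
  define s0 where "s0 = s((''used'', x, x) := 1, (''bracket'', x, 0) := x)"
  have ctx0: "ctx ?n T x s0" unfolding s0_def by (intro ctx_upd ctx) auto
  define I where "I = (\<lambda>k s. ctx ?n T x s \<and> s (''low'', x, 0) = min k (2 ^ M) \<and>
     (\<forall>i>0. s (''low'', x, i) = 0))"
  have "I ?n (sem (FFor ''u'' ?c) s0)"
  proof (rule sem_For_invariant)
    show "wf_for (FFor ''u'' ?c)" by simp
    show "s0 (''n'', 0, 0) = ?n" using ctx0 by (simp add: ctx_def)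
    show "I 0 (s0((''u'', 0, 0) := 0))"
      using ctx0 zero unfolding I_def by (auto simp: s0_def intro: ctx_upd)
  next
    fix k t assume k: "k < ?n" "t (''u'', 0, 0) = k" "t (''n'', 0, 0) = ?n" "I k t"
    have "ctx ?n T x ((sem ?c t)((''u'', 0, 0) := Suc k))"
      using k(4) unfolding I_def by (intro ctx_upd ctx_sem) auto
    moreover have "t (''x'', 0, 0) = x" using k(4) by (simp add: I_def ctx_def)
    ultimately show "I (Suc k) ((sem ?c t)((''u'', 0, 0) := Suc k))"
      using k by (auto simp: I_def expr_val_Times)
  qed
  moreover have "sem init_prog s = sem (FFor ''u'' ?c) s0"
    using ctx by (simp add: init_prog_def s0_def ctx_def)
  ultimately have low: "(sem init_prog s) (''low'', x, i) = ((\<lambda>_. 0)(0 := 2 ^ M)) i" for i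
    by (auto simp: I_def)
  have "(sem init_prog s) (a, x, i) = s0 (a, x, i)" if "a \<in> {''used'', ''bracket''}" for a i
    unfolding \<open>sem init_prog s = _\<close> by (rule sem_unwritten) (use that in auto)
  then show ?thesis
    using low zero by (auto simp: stored_embedding_def s0_def fun_eq_iff)
qed

lemma sem_child_prog:
  assumes ctx: "ctx n T x s" and i: "s (''i'', 0, 0) = i" and u: "s (''u'', 0, 0) = u"
  shows "(stored_embedding x (sem child_prog s), sem child_prog s (''d'', 0, 0)) =
    child_step n T i u (stored_embedding x s, s (''d'', 0, 0))"
  using ctx i u
  by (auto simp: child_prog_def stored_embedding_def expr_val_Times ctx_def fun_eq_iff)

lemma sem_child_scan:
  assumes ctx: "ctx n T x s" and i: "s (''i'', 0, 0) = i" and d: "s (''d'', 0, 0) = 1"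
  shows "stored_embedding x (sem (FFor ''u'' child_prog) s) = fst (child_scan n T i n (stored_embedding x s))"
proof -
  define I where "I = (\<lambda>k t. ctx n T x t \<and> t (''i'', 0, 0) = i \<and>
    (stored_embedding x t, t (''d'', 0, 0)) = child_scan n T i k (stored_embedding x s))"
  have "I n (sem (FFor ''u'' child_prog) s)"
  proof (rule sem_For_invariant)
    show "wf_for (FFor ''u'' child_prog)" by (simp add: prog_defs)
    show "s (''n'', 0, 0) = n" using ctx by (simp add: ctx_def)
    show "I 0 (s((''u'', 0, 0) := 0))"
      using ctx i d by (auto simp: I_def stored_embedding_def intro: ctx_upd)
  next
    fix k t assume k: "k < n" "t (''u'', 0, 0) = k" "I k t"
    let ?t = "(sem child_prog t)((''u'', 0, 0) := Suc k)"
    have "ctx n T x ?t"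
      using k(3) unfolding I_def by (intro ctx_upd ctx_sem) (auto simp: prog_defs)
    moreover have "?t (''i'', 0, 0) = i"
      using k(3) by (simp add: I_def sem_unwritten prog_defs)
    moreover have "stored_embedding x ?t = stored_embedding x (sem child_prog t)"
      by (rule stored_embedding_cong) auto
    ultimately show "I (Suc k) ?t"
      using k sem_child_prog[of n T x t i k] by (auto simp: I_def)
  qed
  then show ?thesis unfolding I_def by (metis fst_conv)
qed

lemma sem_greedy_prog:
  assumes ctx: "ctx n T x s" and init: "stored_embedding x s = greedy M n T x 0"
  shows "stored_embedding x (sem greedy_prog s) = greedy M n T x n"
proof -
  define I where "I = (\<lambda>k t. ctx n T x t \<and> stored_embedding x t = greedy M n T x k)"
  let ?c = "FSeq (assign ''d'' (Num 1)) (FFor ''u'' child_prog)"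
  have "I n (sem (FFor ''i'' ?c) s)"
  proof (rule sem_For_invariant)
    show "wf_for (FFor ''i'' ?c)" by (simp add: prog_defs)
    show "s (''n'', 0, 0) = n" using ctx by (simp add: ctx_def)
    show "I 0 (s((''i'', 0, 0) := 0))"
      using ctx init by (auto simp: I_def stored_embedding_def intro: ctx_upd)
  next
    fix k t assume k: "k < n" "t (''i'', 0, 0) = k" "I k t"
    let ?t = "(sem ?c t)((''i'', 0, 0) := Suc k)"
    define t1 where "t1 = t((''d'', 0, 0) := 1)"
    have c1: "ctx n T x t1" using k(3) unfolding I_def t1_def by (intro ctx_upd) auto
    have "ctx n T x ?t"
      using k(3) unfolding I_def by (intro ctx_upd ctx_sem) (auto simp: prog_defs)
    moreover have "stored_embedding x t1 = greedy M n T x k"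
      using k(3) by (auto simp: I_def t1_def stored_embedding_def)
    moreover have "stored_embedding x ?t = stored_embedding x (sem ?c t)"
      by (rule stored_embedding_cong) auto
    moreover have "sem ?c t = sem (FFor ''u'' child_prog) t1"
      by (simp add: t1_def)
    ultimately show "I (Suc k) ?t"
      using sem_child_scan[OF c1, of k] k(2) unfolding I_def by (simp add: t1_def del: sem.simps)
  qed
  then show ?thesis by (simp add: I_def greedy_prog_def)
qed

lemma written_progs:
  "written init_prog = {''used'', ''bracket'', ''low'', ''u''}"
  "written greedy_prog = {''used'', ''bracket'', ''low'', ''u'', ''i'', ''d''}"
  "written cheapest_prog = {''y'', ''best''}"
  "written bid_prog = {''c'', ''best'', ''y'', ''own'', ''lab'', ''tmp''}"
  "written auction_prog = {''i'', ''p'', ''q'', ''c'', ''best'', ''y'', ''own'', ''lab'', ''tmp''}"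
  "written output_prog = {''y'', ''bracket''}"
  by (auto simp: prog_defs)

lemma sem_cheapest_prog:
  assumes ctx: "ctx n T x s" and emb: "stored_embedding x s = \<sigma>"
    and c: "s (''c'', 0, 0) = c" and best: "s (''best'', 0, 0) = 0"
  defines "z \<equiv> sem cheapest_prog s (''best'', 0, 0)"
  shows "if z = 0 then wants n T \<sigma> c = {}
    else z - 1 \<in> wants n T \<sigma> c \<and> (\<forall>y\<in>wants n T \<sigma> c. s (''lab'', x, z - 1) \<le> s (''lab'', x, y))"
proof -
  define P where "P = (\<lambda>k z. if z = 0 then \<forall>y<k. y \<notin> wants n T \<sigma> c
    else z - 1 \<in> wants n T \<sigma> c \<and>
      (\<forall>y<k. y \<in> wants n T \<sigma> c \<longrightarrow> s (''lab'', x, z - 1) \<le> s (''lab'', x, y)))"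
  define I where "I = (\<lambda>k t. (\<forall>a i j. a \<notin> {''y'', ''best''} \<longrightarrow> t (a, i, j) = s (a, i, j)) \<and>
    P k (t (''best'', 0, 0)))"
  obtain body where body: "cheapest_prog = FFor ''y'' body" by (simp add: cheapest_prog_def)
  have wf: "wf_for (FFor ''y'' body)" unfolding body[symmetric] by (simp add: prog_defs)
  have written: "written body = {''best''}" using body by (auto simp: cheapest_prog_def)
  have "I n (sem (FFor ''y'' body) s)"
  proof (rule sem_For_invariant[OF wf])
    show "s (''n'', 0, 0) = n" using ctx by (simp add: ctx_def)
    show "I 0 (s((''y'', 0, 0) := 0))" using best by (auto simp: I_def P_def)
  next
    fix k t assume k: "k < n" "t (''y'', 0, 0) = k" "I k t"
    have same: "t (a, i, j) = s (a, i, j)" if "a \<notin> {''y'', ''best''}" for a i j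
      using k(3) that by (simp add: I_def)
    have x: "s (''x'', 0, 0) = x" and T: "s (''dominates'', i, j) = (if (i, j) \<in> T then 1 else 0)" for i j
      using ctx by (simp_all add: ctx_def)
    have e: "s (''used'', x, j) = snd (snd \<sigma>) j" "s (''bracket'', x, 2 * j) = fst \<sigma> j" for j
      using emb by (auto simp: stored_embedding_def)
    have kN: "k \<in> wants n T \<sigma> c \<longleftrightarrow> s (''used'', x, k) = 0 \<and> (s (''bracket'', x, 2 * (c - 1)), k) \<in> T"
      using k(1) by (simp add: wants_def e)
    let ?z = "t (''best'', 0, 0)"
    have Pk: "P k ?z" using k(3) by (simp add: I_def)
    have z': "sem body t (''best'', 0, 0) =
      (if k \<in> wants n T \<sigma> c \<and> (?z = 0 \<or> s (''lab'', x, k) < s (''lab'', x, ?z - 1)) then k + 1 else ?z)"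
      using body k(2) unfolding kN
      by (auto simp: cheapest_prog_def same x c T expr_val_Times)
    have "P (Suc k) (sem body t (''best'', 0, 0))"
    proof (cases "k \<in> wants n T \<sigma> c \<and> (?z = 0 \<or> s (''lab'', x, k) < s (''lab'', x, ?z - 1))")
      case True
      have "s (''lab'', x, k) \<le> s (''lab'', x, y)" if "y < Suc k" "y \<in> wants n T \<sigma> c" for y
      proof (cases "y = k")
        case False
        then have "?z \<noteq> 0" "s (''lab'', x, ?z - 1) \<le> s (''lab'', x, y)"
          using that Pk by (auto simp: P_def split: if_splits)
        then show ?thesis using True by linarith
      qed simp
      moreover have "sem body t (''best'', 0, 0) = k + 1" using True z' by argo
      ultimately show ?thesis using True by (simp add: P_def)
    next
      case False
      then have "sem body t (''best'', 0, 0) = ?z" using z' by argo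
      then show ?thesis using False Pk by (auto simp: P_def less_Suc_eq split: if_splits)
    qed
    moreover have "(sem body t) (a, i, j) = s (a, i, j)" if "a \<notin> {''y'', ''best''}" for a i j
      using same that by (simp add: sem_unwritten written)
    ultimately show "I (Suc k) ((sem body t)((''y'', 0, 0) := Suc k))"
      by (simp add: I_def)
  qed
  then have "P n z" by (simp add: I_def z_def body)
  moreover have "y < n" if "y \<in> wants n T \<sigma> c" for y using that by (simp add: wants_def)
  ultimately show ?thesis by (auto simp: P_def split: if_splits)
qed

text \<open>After \<open>t\<close> bids the prices add up to at least \<open>t\<close>, so bounded prices end the auction.\<close>

definition auction_state ::
  "nat \<Rightarrow> (nat \<Rightarrow> nat set) \<Rightarrow> nat \<Rightarrow> nat \<Rightarrow> nat \<Rightarrow> nat \<Rightarrow> store \<Rightarrow> bool" where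
  "auction_state n N k m x t s \<longleftrightarrow>
     auction_inv N k (\<lambda>y. s (''own'', x, y)) (\<lambda>y. s (''lab'', x, y)) (s (''c'', 0, 0)) \<and>
     (\<forall>y. s (''lab'', x, y) \<le> m) \<and>
     (s (''c'', 0, 0) = 0 \<or> t \<le> (\<Sum>y<n. s (''lab'', x, y)))"

definition perfect_market :: "nat \<Rightarrow> (nat \<times> nat) set \<Rightarrow> embedding \<Rightarrow> nat \<Rightarrow> bool" where
  "perfect_market n T \<sigma> m \<longleftrightarrow> hall (wants n T \<sigma>) m \<and> card {y. y < n \<and> snd (snd \<sigma>) y = 0} = m"

text \<open>Hall's condition for \<open>{c}\<close> yields an item to bid on, and
  \<open>auction_label_less\<close> with the cheapest price as \<open>q\<close> keeps the raised
  price at most \<open>m\<close>. If nobody is bidding, the disjunct for \<open>0\<close> absorbs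
  the larger count.\<close>

lemma sem_bid_prog:
  assumes ctx: "ctx n T x s" and emb: "stored_embedding x s = \<sigma>"
    and market: "perfect_market n T \<sigma> m" and "k \<le> m"
    and st: "auction_state n (wants n T \<sigma>) k m x t s"
  shows "auction_state n (wants n T \<sigma>) k m x (Suc t) (sem bid_prog s)"
proof (cases "s (''c'', 0, 0) = 0")
  case True
  then show ?thesis using st by (simp add: bid_prog_def auction_state_def)
next
  case False
  define c where "c = s (''c'', 0, 0)"
  define own where "own = (\<lambda>y. s (''own'', x, y))"
  define lab where "lab = (\<lambda>y. s (''lab'', x, y))"
  let ?N = "wants n T \<sigma>"
  have inv: "auction_inv ?N k own lab c" and labs: "\<And>y. lab y \<le> m" and sum: "t \<le> (\<Sum>y<n. lab y)"
    using st False by (simp_all add: auction_state_def own_def lab_def c_def)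
  have c: "c \<noteq> 0" using False by (simp add: c_def)
  define s1 where "s1 = s((''best'', 0, 0) := 0)"
  define s2 where "s2 = sem cheapest_prog s1"
  have ctx1: "ctx n T x s1" using ctx unfolding s1_def by (intro ctx_upd) auto
  have emb1: "stored_embedding x s1 = \<sigma>"
    using emb by (simp add: s1_def stored_embedding_def)
  have ctx2: "ctx n T x s2" unfolding s2_def using ctx1 by (intro ctx_sem) (auto simp: written_progs)
  have s2: "s2 (a, i, j) = s (a, i, j)" if "a \<notin> {''best'', ''y''}" for a i j
    using that by (simp add: s2_def s1_def sem_unwritten written_progs)
  define z where "z = s2 (''best'', 0, 0)"
  have z: "if z = 0 then ?N c = {} else z - 1 \<in> ?N c \<and> (\<forall>y\<in>?N c. lab (z - 1) \<le> lab y)"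
  proof -
    have "s1 (''c'', 0, 0) = c" "s1 (''best'', 0, 0) = 0" and lab1: "\<And>y. s1 (''lab'', x, y) = lab y"
      by (auto simp: s1_def c_def lab_def)
    from sem_cheapest_prog[OF ctx1 emb1 this(1,2)] show ?thesis
      unfolding lab1 s2_def[symmetric] z_def[symmetric] .
  qed
  have "c \<in> {1..k}"
    using inv c unfolding auction_inv_def by blast
  then have "?N c \<noteq> {}"
    using hall_nonempty[of ?N m c] market \<open>k \<le> m\<close> by (auto simp: perfect_market_def)
  then have z0: "z \<noteq> 0" using z by auto
  define y where "y = z - 1"
  have y: "y \<in> ?N c" "\<And>y'. y' \<in> ?N c \<Longrightarrow> lab y \<le> lab y'" "y < n"
    using z z0 by (auto simp: y_def wants_def)
  have eq: "sem bid_prog s = sem take_prog s2"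
    using False z0 by (simp add: bid_prog_def s2_def s1_def z_def)
  have x2: "s2 (''x'', 0, 0) = x" using ctx2 by (simp add: ctx_def)
  have own': "(\<lambda>y. sem bid_prog s (''own'', x, y)) = own(y := c)"
    and lab': "(\<lambda>y. sem bid_prog s (''lab'', x, y)) = lab(y := Suc (lab y))"
    and c': "sem bid_prog s (''c'', 0, 0) = own y"
    unfolding eq using x2 s2
    by (auto simp: take_prog_def own_def lab_def c_def y_def fun_eq_iff simp flip: z_def)
  have inv': "auction_inv ?N k (own(y := c)) (lab(y := Suc (lab y))) (own y)"
    by (rule auction_step[OF inv c y(1,2)])
  have "lab y < m"
    by (rule auction_label_less[OF inv c \<open>k \<le> m\<close>, where Y = "{y. y < n \<and> snd (snd \<sigma>) y = 0}"])
      (use market y(2) in \<open>auto simp: perfect_market_def wants_def\<close>)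
  moreover have "Suc t \<le> (\<Sum>y'<n. (lab(y := Suc (lab y))) y')"
  proof -
    have "(\<Sum>y'<n. lab y') < (\<Sum>y'<n. (lab(y := Suc (lab y))) y')"
      by (rule sum_strict_mono_ex1) (use y(3) in auto)
    then show ?thesis using sum by simp
  qed
  moreover have "(lab(y := Suc (lab y))) y' \<le> m" for y'
    using labs[of y'] \<open>lab y < m\<close> by simp
  ultimately show ?thesis
    unfolding auction_state_def own' lab' c' fun_cong[OF lab'] using inv' by blast
qed

lemma stored_embedding_sem:
  "{''bracket'', ''low'', ''used''} \<inter> written c = {} \<Longrightarrow> stored_embedding x (sem c s) = stored_embedding x s"
  by (rule stored_embedding_cong) (auto intro: sem_unwritten)

lemma sem_bid_loop:
  assumes ctx: "ctx n T x s" and emb: "stored_embedding x s = \<sigma>"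
    and market: "perfect_market n T \<sigma> m" and "k \<le> m"
    and st: "auction_state n (wants n T \<sigma>) k m x t s"
  shows "auction_state n (wants n T \<sigma>) k m x (t + n * n) (sem (FFor ''p'' (FFor ''q'' bid_prog)) s)"
proof -
  define I where "I = (\<lambda>t s. ctx n T x s \<and> stored_embedding x s = \<sigma> \<and>
    auction_state n (wants n T \<sigma>) k m x t s)"
  have I_upd: "I t (s((v, 0, 0) := z))" if "I t s" "v \<in> {''p'', ''q''}" for t s v z
    using that ctx_upd[of n T x s v] by (auto simp: I_def auction_state_def stored_embedding_def)
  have inner: "I (t + n) (sem (FFor ''q'' bid_prog) s)" if "I t s" for t s
  proof (rule sem_For_invariant[where I = "\<lambda>j. I (t + j)"])
    show "wf_for (FFor ''q'' bid_prog)" by (simp add: prog_defs)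
    show "s (''n'', 0, 0) = n" using that by (simp add: I_def ctx_def)
    show "I (t + 0) (s((''q'', 0, 0) := 0))" using I_upd[OF that] by simp
  next
    fix j s assume "I (t + j) s"
    then have "I (t + Suc j) (sem bid_prog s)"
      using sem_bid_prog[of n T x s \<sigma> m k "t + j"] market \<open>k \<le> m\<close>
      unfolding I_def by (auto simp: written_progs stored_embedding_sem intro!: ctx_sem)
    then show "I (t + Suc j) ((sem bid_prog s)((''q'', 0, 0) := Suc j))" by (rule I_upd) simp
  qed
  have "I (t + n * n) (sem (FFor ''p'' (FFor ''q'' bid_prog)) s)"
  proof (rule sem_For_invariant[where I = "\<lambda>j. I (t + j * n)"])
    show "wf_for (FFor ''p'' (FFor ''q'' bid_prog))" by (simp add: prog_defs)
    show "s (''n'', 0, 0) = n" using ctx by (simp add: ctx_def)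
    have "I t s" using ctx emb st by (simp add: I_def)
    from I_upd[OF this] show "I (t + 0 * n) (s((''p'', 0, 0) := 0))" by simp
  next
    fix j s assume "I (t + j * n) s"
    then have "I (t + Suc j * n) (sem (FFor ''q'' bid_prog) s)"
      using inner[of "t + j * n" s] by (simp add: algebra_simps del: sem.simps)
    then show "I (t + Suc j * n) ((sem (FFor ''q'' bid_prog) s)((''p'', 0, 0) := Suc j))"
      by (rule I_upd) simp
  qed
  then show ?thesis by (simp add: I_def del: sem.simps)
qed

lemma sem_auction_prog:
  assumes ctx: "ctx n T x s" and emb: "stored_embedding x s = \<sigma>"
    and n: "n = 2 * m" "m > 0" and market: "perfect_market n T \<sigma> m"
    and zero: "\<And>a i. a \<in> {''own'', ''lab''} \<Longrightarrow> s (a, x, i) = 0"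
  shows "auction_inv (wants n T \<sigma>) m (\<lambda>y. sem auction_prog s (''own'', x, y))
    (\<lambda>y. sem auction_prog s (''lab'', x, y)) 0"
proof -
  let ?loop = "FFor ''p'' (FFor ''q'' bid_prog)"
  let ?work = "FSeq (assign ''c'' (Add (Var ''i'') (Num 1))) ?loop"
  let ?c = "FCond (Sub (Var ''n'') (Times 2 (Var ''i''))) ?work FSkip"
  \<comment> \<open>The minimum appears because the loop runs to \<open>n = 2 * m\<close>, while
    only its first \<open>m\<close> rounds introduce a bidder.\<close>
  define I where "I = (\<lambda>k t. ctx n T x t \<and> stored_embedding x t = \<sigma> \<and>
    auction_inv (wants n T \<sigma>) (min k m) (\<lambda>y. t (''own'', x, y)) (\<lambda>y. t (''lab'', x, y)) 0 \<and>
    (\<forall>y. t (''lab'', x, y) \<le> m))"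
  have "I n (sem (FFor ''i'' ?c) s)"
  proof (rule sem_For_invariant)
    show "wf_for (FFor ''i'' ?c)" by (simp add: prog_defs)
    show "s (''n'', 0, 0) = n" using ctx by (simp add: ctx_def)
    show "I 0 (s((''i'', 0, 0) := 0))"
      using ctx emb zero by (auto simp: I_def auction_inv_def stored_embedding_def intro: ctx_upd)
  next
    fix k t assume k: "k < n" "t (''i'', 0, 0) = k" "t (''n'', 0, 0) = n" "I k t"
    have "I (Suc k) (sem ?c t)"
    proof (cases "k < m")
      case True
      define t1 where "t1 = t((''c'', 0, 0) := Suc k)"
      define t2 where "t2 = sem ?loop t1"
      have eq: "sem ?c t = t2" using True k n by (simp add: t1_def t2_def expr_val_Times)
      have ctx1: "ctx n T x t1" using k(4) unfolding I_def t1_def by (intro ctx_upd) auto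
      have emb1: "stored_embedding x t1 = \<sigma>"
        using k(4) by (simp add: I_def t1_def stored_embedding_def)
      have "auction_state n (wants n T \<sigma>) (Suc k) m x 0 t1"
        using k(4) True auction_start[of "wants n T \<sigma>" k]
        by (simp add: I_def auction_state_def t1_def)
      from sem_bid_loop[OF ctx1 emb1 market _ this]
      have st: "auction_state n (wants n T \<sigma>) (Suc k) m x (n * n) t2"
        using True by (simp add: t2_def del: sem.simps)
      \<comment> \<open>A bidder still waiting after \<open>n * n\<close> bids would force the
        prices to add up to at least \<open>n * n\<close>.\<close>
      have "(\<Sum>y<n. t2 (''lab'', x, y)) \<le> n * m"
        using sum_bounded_above[of "{..<n}" "\<lambda>y. t2 (''lab'', x, y)" m] st
        by (simp add: auction_state_def)
      also have "\<dots> < n * n" using n by simp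
      finally have "t2 (''c'', 0, 0) = 0" using st by (auto simp: auction_state_def)
      moreover have "ctx n T x t2"
        unfolding t2_def using ctx1 by (intro ctx_sem) (auto simp: written_progs)
      moreover have "stored_embedding x t2 = \<sigma>"
        unfolding t2_def by (subst stored_embedding_sem) (auto simp: written_progs emb1)
      ultimately show ?thesis
        unfolding eq I_def using st True by (simp add: auction_state_def)
    next
      case False
      then have "sem ?c t = t" using k n by (simp add: expr_val_Times)
      then show ?thesis using k(4) False by (simp add: I_def)
    qed
    then show "I (Suc k) ((sem ?c t)((''i'', 0, 0) := Suc k))"
      unfolding I_def by (auto simp: stored_embedding_def intro: ctx_upd)
  qed
  then show ?thesis using n unfolding I_def auction_prog_def by simp
qed

lemma sem_output_prog:
  assumes ctx: "ctx n T x s"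
    and inj: "inj_on (\<lambda>y. s (''own'', x, y)) {y. s (''own'', x, y) \<noteq> 0}"
    and less: "\<And>y. s (''own'', x, y) \<noteq> 0 \<Longrightarrow> y < n"
  shows "sem output_prog s (''bracket'', x, 2 * i) = s (''bracket'', x, 2 * i)"
    and "s (''own'', x, y) \<noteq> 0 \<Longrightarrow> sem output_prog s (''bracket'', x, 2 * s (''own'', x, y) - 1) = y"
proof -
  let ?c = "FCond (Row ''own'' (Var ''y''))
      (row_assign ''bracket'' (Sub (Times 2 (Row ''own'' (Var ''y''))) (Num 1)) (Var ''y'')) FSkip"
  define own where "own = (\<lambda>y. s (''own'', x, y))"
  define I where "I = (\<lambda>k t. ctx n T x t \<and> (\<forall>y. t (''own'', x, y) = own y) \<and>
    (\<forall>i. t (''bracket'', x, 2 * i) = s (''bracket'', x, 2 * i)) \<and>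
    (\<forall>y<k. own y \<noteq> 0 \<longrightarrow> t (''bracket'', x, 2 * own y - 1) = y))"
  have "I n (sem (FFor ''y'' ?c) s)"
  proof (rule sem_For_invariant)
    show "wf_for (FFor ''y'' ?c)" by simp
    show "s (''n'', 0, 0) = n" using ctx by (simp add: ctx_def)
    show "I 0 (s((''y'', 0, 0) := 0))"
      using ctx by (auto simp: I_def own_def intro: ctx_upd)
  next
    fix k t assume k: "k < n" "t (''y'', 0, 0) = k" "t (''n'', 0, 0) = n" "I k t"
    have x: "t (''x'', 0, 0) = x" using k(4) by (simp add: I_def ctx_def)
    have "I (Suc k) (sem ?c t)"
    proof (cases "own k = 0")
      case True
      then have "sem ?c t = t" using k x by (simp add: I_def)
      then show ?thesis using k(4) True by (auto simp: I_def less_Suc_eq)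
    next
      case False
      then have eq: "sem ?c t = t((''bracket'', x, 2 * own k - 1) := k)"
        using k x by (simp add: I_def expr_val_Times)
      have ctx': "ctx n T x (sem ?c t)"
        using k(4) unfolding eq I_def by (intro ctx_upd) auto
      \<comment> \<open>\<open>own k \<noteq> 0\<close> matters: truncated subtraction would
        otherwise address leaf \<open>0\<close>.\<close>
      have odd: "2 * i \<noteq> 2 * own k - 1" for i using False by presburger
      have diff: "2 * own y - 1 \<noteq> 2 * own k - 1" if "y < k" "own y \<noteq> 0" for y
      proof
        assume "2 * own y - 1 = 2 * own k - 1"
        then have "own y = own k" using that(2) False by linarith
        then show False using inj_onD[OF inj, of y k] that False by (simp add: own_def)
      qed
      show ?thesis
        using k(4) ctx' odd diff unfolding eq I_def by (auto simp: less_Suc_eq)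
    qed
    then show "I (Suc k) ((sem ?c t)((''y'', 0, 0) := Suc k))"
      unfolding I_def by (auto intro: ctx_upd)
  qed
  then have I: "I n (sem output_prog s)" by (simp only: output_prog_def)
  show "sem output_prog s (''bracket'', x, 2 * i) = s (''bracket'', x, 2 * i)"
    using I by (simp add: I_def)
  show "s (''own'', x, y) \<noteq> 0 \<Longrightarrow> sem output_prog s (''bracket'', x, 2 * s (''own'', x, y) - 1) = y"
    using I less[of y] by (auto simp: I_def own_def)
qed

text \<open>The interface between algorithm and probability: a deterministic condition under which
  the program succeeds for \<open>x\<close>, and the event whose failure probability is
  bounded.\<close>

definition solvable :: "nat \<Rightarrow> (nat \<times> nat) set \<Rightarrow> nat \<Rightarrow> bool" where
  "solvable M T x \<longleftrightarrow> greedy_succeeds M (2 ^ Suc M) T x (2 ^ Suc M) \<and>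
     hall (wants (2 ^ Suc M) T (greedy M (2 ^ Suc M) T x (2 ^ Suc M))) (2 ^ M)"

lemma card_unused:
  assumes "embeds M (2 ^ Suc M) T x {..<2 ^ M} \<sigma>" "x < 2 ^ Suc M"
  shows "card {y. y < 2 ^ Suc M \<and> snd (snd \<sigma>) y = 0} = 2 ^ M"
proof -
  obtain b l w where s: "\<sigma> = (b, l, w)" by (metis prod.collapse)
  have E: "embeds M (2 ^ Suc M) T x {..<2 ^ M} (b, l, w)" using assms s by simp
  have inj: "inj_on b {..<2 ^ M}" and b0: "b 0 = x"
    and w: "\<forall>u. w u = (if u \<in> b ` {..<2 ^ M} then 1 else 0)"
    and pool: "b ` ({..<2 ^ M} - {0}) \<subseteq> pool (2 ^ Suc M)"
    using E unfolding embeds.simps by - (elim conjE, assumption)+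
  have sub: "b ` {..<2 ^ M} \<subseteq> {..<2 ^ Suc M}"
  proof
    fix u assume "u \<in> b ` {..<2 ^ M}"
    then show "u \<in> {..<2 ^ Suc M}"
      using pool b0 assms(2) pool_subset[of "2 ^ Suc M"] by (cases "u = x") auto
  qed
  have "{y. y < 2 ^ Suc M \<and> snd (snd \<sigma>) y = 0} = {..<2 ^ Suc M} - b ` {..<2 ^ M}"
    using w by (auto simp: s)
  also have "card \<dots> = 2 ^ Suc M - 2 ^ M"
    using sub inj by (subst card_Diff_subset) (auto simp: card_image)
  finally show ?thesis by simp
qed

lemma sem_row_wins:
  assumes ctx: "ctx (2 ^ Suc M) T x s" and x: "x < 2 ^ Suc M" and solv: "solvable M T x"
    and zero: "\<And>a i. a \<in> {''bracket'', ''low'', ''used'', ''own'', ''lab''} \<Longrightarrow> s (a, x, i) = 0"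
  shows "wins_under {..<2 ^ Suc M} T (Suc M)
    (\<lambda>k. sem (FSeq init_prog (FSeq greedy_prog (FSeq auction_prog output_prog))) s (''bracket'', x, k)) x"
proof -
  let ?n = "2 ^ Suc M :: nat"
  define s1 where "s1 = sem init_prog s"
  define s2 where "s2 = sem greedy_prog s1"
  define s3 where "s3 = sem auction_prog s2"
  define \<sigma> where "\<sigma> = greedy M ?n T x ?n"
  have ctx1: "ctx ?n T x s1" unfolding s1_def using ctx by (intro ctx_sem) (auto simp: written_progs)
  have ctx2: "ctx ?n T x s2" unfolding s2_def using ctx1 by (intro ctx_sem) (auto simp: written_progs)
  have ctx3: "ctx ?n T x s3" unfolding s3_def using ctx2 by (intro ctx_sem) (auto simp: written_progs)
  have "stored_embedding x s1 = greedy M ?n T x 0"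
    unfolding s1_def using ctx zero by (intro sem_init_prog) auto
  then have emb2: "stored_embedding x s2 = \<sigma>"
    unfolding s2_def \<sigma>_def by (rule sem_greedy_prog[OF ctx1])
  have "embeds M ?n T x (reached M ?n) \<sigma>"
    using solv unfolding \<sigma>_def solvable_def by (intro greedy_embeds) auto
  then have emb: "embeds M ?n T x {..<2 ^ M} \<sigma>" by (simp add: reached_full)
  have market: "perfect_market ?n T \<sigma> (2 ^ M)"
    using solv card_unused[OF emb x] by (simp add: perfect_market_def solvable_def \<sigma>_def)
  have inv: "auction_inv (wants ?n T \<sigma>) (2 ^ M) (\<lambda>y. s3 (''own'', x, y)) (\<lambda>y. s3 (''lab'', x, y)) 0"
    unfolding s3_def
    by (rule sem_auction_prog[OF ctx2 emb2 _ _ market])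
      (use zero in \<open>auto simp: s2_def s1_def sem_unwritten written_progs\<close>)
  have inj: "inj_on (\<lambda>y. s3 (''own'', x, y)) {y. s3 (''own'', x, y) \<noteq> 0}"
    and own: "\<forall>y. s3 (''own'', x, y) \<noteq> 0 \<longrightarrow> y \<in> wants ?n T \<sigma> (s3 (''own'', x, y))"
    using inv unfolding auction_inv_def by - (elim conjE, assumption)+
  have less: "y < ?n" if "s3 (''own'', x, y) \<noteq> 0" for y
    using own that by (auto simp: wants_def)
  have emb3: "stored_embedding x s3 = \<sigma>"
    unfolding s3_def by (subst stored_embedding_sem) (auto simp: written_progs emb2)
  have "wins_under {..<?n} T (Suc M) (\<lambda>k. sem output_prog s3 (''bracket'', x, k)) x"
  proof (rule wins_under_from_matching[OF emb x inv])
    show "sem output_prog s3 (''bracket'', x, 2 * i) = fst \<sigma> i" for i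
      using sem_output_prog(1)[OF ctx3 inj less] emb3 by (auto simp: stored_embedding_def)
    show "sem output_prog s3 (''bracket'', x, 2 * s3 (''own'', x, y) - 1) = y"
      if "s3 (''own'', x, y) \<noteq> 0" for y
      by (rule sem_output_prog(2)[OF ctx3 inj less that])
  qed
  then show ?thesis by (simp add: s1_def s2_def s3_def)
qed

text \<open>The invariant keeps the rows from \<open>k\<close> on at \<open>0\<close>, since each
  pass relies on blank arrays, and the brackets below \<open>k\<close> survive by
  \<open>sem_other_row\<close>.\<close>

lemma bracket_prog_computes:
  assumes "\<And>x. x < 2 ^ Suc M \<Longrightarrow> solvable M T x"
  shows "computes_winning_brackets (compile bracket_prog) (Suc M) T"
proof -
  let ?n = "2 ^ Suc M :: nat"
  let ?c = "FSeq init_prog (FSeq greedy_prog (FSeq auction_prog output_prog))"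
  let ?A = "{''bracket'', ''low'', ''used'', ''own'', ''lab''}"
  define s where "s = input_store ?n T"
  define I where "I = (\<lambda>k t. ctx ?n T k (t((''x'', 0, 0) := k)) \<and>
    (\<forall>a\<in>?A. \<forall>x\<ge>k. \<forall>i. t (a, x, i) = 0) \<and>
    (\<forall>x<k. wins_under {..<?n} T (Suc M) (\<lambda>j. t (''bracket'', x, j)) x))"
  have wf: "wf_for (FFor ''x'' ?c)" using wf_bracket_prog by (simp add: bracket_prog_def)
  have written: "{''n'', ''x'', ''dominates''} \<inter> written ?c = {}" by (simp add: written_progs)
  have "I ?n (sem (FFor ''x'' ?c) s)"
  proof (rule sem_For_invariant[OF wf])
    show "s (''n'', 0, 0) = ?n" by (simp add: s_def input_store_def)
    show "I 0 (s((''x'', 0, 0) := 0))"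
      by (auto simp: I_def ctx_def s_def input_store_def)
  next
    fix k t assume k: "k < ?n" "t (''x'', 0, 0) = k" "I k t"
    have t: "t((''x'', 0, 0) := k) = t" using k(2) by auto
    have ctx: "ctx ?n T k t" using k(3) by (simp add: I_def t)
    have row: "sem ?c t (a, x, i) = t (a, x, i)" if "a \<in> ?A" "x \<noteq> k" for a x i
      by (rule sem_other_row) (use that k(2) in \<open>auto simp: prog_defs\<close>)
    define t' where "t' = sem ?c t"
    have row': "t' (a, x, i) = t (a, x, i)" if "a \<in> ?A" "x \<noteq> k" for a x i
      unfolding t'_def using that by (rule row)
    have zero: "\<forall>a\<in>?A. \<forall>x\<ge>k. \<forall>i. t (a, x, i) = 0"
      and wins: "\<forall>x<k. wins_under {..<?n} T (Suc M) (\<lambda>j. t (''bracket'', x, j)) x"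
      using k(3) unfolding I_def by - (elim conjE, assumption)+
    have new: "wins_under {..<?n} T (Suc M) (\<lambda>j. t' (''bracket'', k, j)) k"
      unfolding t'_def by (rule sem_row_wins[OF ctx k(1) assms[OF k(1)]]) (use zero in auto)
    have "wins_under {..<?n} T (Suc M) (\<lambda>j. t' (''bracket'', x, j)) x" if "x < Suc k" for x
    proof (cases "x = k")
      case False
      then have "x < k" using that by simp
      then show ?thesis using wins by (simp add: row')
    qed (use new in simp)
    moreover have "ctx ?n T (Suc k) (t'((''x'', 0, 0) := Suc k))"
      using ctx_sem[OF ctx written] unfolding t'_def[symmetric] by (simp add: ctx_def)
    moreover have "t' (a, x, i) = 0" if "a \<in> ?A" "x \<ge> Suc k" for a x i
    proof -
      have "t (a, x, i) = 0" using bspec[OF zero that(1)] Suc_leD[OF that(2)] by blast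
      then show ?thesis using row'[OF that(1), of x i] that(2) by simp
    qed
    ultimately have "I (Suc k) (t'((''x'', 0, 0) := Suc k))"
      unfolding I_def by simp
    then show "I (Suc k) ((sem ?c t)((''x'', 0, 0) := Suc k))" unfolding t'_def .
  qed
  moreover obtain t where "exec (compile bracket_prog) s t (sem bracket_prog s)"
    using exec_compile[OF wf_bracket_prog] by blast
  ultimately show ?thesis
    unfolding computes_winning_brackets_def s_def I_def bracket_prog_def by blast
qed

lemma polynomial_time_compile:
  assumes "wf_for c"
  shows "polynomial_time (compile c)"
proof -
  have "input_store n T (''n'', 0, 0) = n" for n T by (simp add: input_store_def)
  then show ?thesis
    unfolding polynomial_time_def using exec_compile[OF assms] by metis
qed

section \<open>Failure probabilities\<close>

lemma pair_key_eqD: "pair_key e = pair_key e' \<Longrightarrow> e = e' \<or> e = prod.swap e'"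
  by (cases e; cases e') (auto simp: pair_key_def min_def max_def split: if_splits)

lemma card_pool: "9 * n \<le> 16 * card (pool n)" "16 * card (pool n) \<le> 9 * n + 15"
proof -
  have "pool n = {..<(9 * n + 15) div 16}" by (auto simp: pool_def)
  then have "card (pool n) = (9 * n + 15) div 16" by simp
  then show "9 * n \<le> 16 * card (pool n)" "16 * card (pool n) \<le> 9 * n + 15" by auto
qed

lemma finite_pool: "finite (pool n)"
  using pool_subset finite_subset by blast

lemma embeds_facts:
  assumes "embeds M n T x A \<sigma>"
  shows "inj_on (fst \<sigma>) A" "\<And>u. snd (snd \<sigma>) u = (if u \<in> fst \<sigma> ` A then 1 else 0)"
    "fst \<sigma> ` (A - {0}) \<subseteq> pool n" "fst \<sigma> 0 = x"
  using assms by (cases \<sigma>; simp)+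

text \<open>As \<open>a\<close> and \<open>m + 1 - a\<close> are complementary up to one, either
  binomial coefficient can be bounded through the smaller of the two. This limits the number of
  obstructions in the union bound.\<close>

lemma choose_complement_le:
  assumes "1 \<le> a" "a \<le> m"
  shows "m choose a \<le> m ^ min a (m + 1 - a)" "m choose (m + 1 - a) \<le> m ^ min a (m + 1 - a)"
proof -
  have c: "m choose k \<le> m ^ k" "m choose k \<le> m ^ (m - k)" if "k \<le> m" for k
    using that binomial_le_pow[of k m] binomial_le_pow[of "m - k" m] binomial_symmetric[of k m]
    by auto
  have p: "i \<le> j \<Longrightarrow> m ^ i \<le> m ^ j" for i j using assms by (intro power_increasing) auto
  have "m - a \<le> m + 1 - a" "m + 1 - a \<le> m" "m - (m + 1 - a) \<le> a" using assms by linarith+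
  then show "m choose a \<le> m ^ min a (m + 1 - a)" "m choose (m + 1 - a) \<le> m ^ min a (m + 1 - a)"
    using c[OF assms(2)] c[of "m + 1 - a"] p by (auto simp: min_def intro: le_trans)
qed

section \<open>Failure bounds for a fixed number of alternatives\<close>

locale dense_model =
  fixes M n :: nat and p :: "nat \<Rightarrow> nat \<Rightarrow> real" and \<delta> :: real
  assumes n: "n = 2 ^ Suc M"
    and model: "model_probabilities n p"
    and dense: "\<And>i j. i < n \<Longrightarrow> j < n \<Longrightarrow> i \<noteq> j \<Longrightarrow> \<delta> \<le> p i j"
    and \<delta>: "0 \<le> \<delta>" "\<delta> \<le> 1"
begin

abbreviation prob :: "(nat \<times> nat) set set \<Rightarrow> real" where
  "prob \<equiv> measure_pmf.prob (random_tournament n p)"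

lemma prob_greedy_step_fails:
  assumes x: "x < n" and i: "i < 2 ^ M" "even i"
  shows "prob {T. greedy_succeeds M n T x i \<and> card (unused_successors n T (greedy M n T x i) i) < M}
    \<le> 2 ^ M * exp (- \<delta> * n / 32)"
proof -
  define G where "G = {greedy M n T x i | T. greedy_succeeds M n T x i}"
  define F where "F = (\<lambda>\<sigma>. {T. card (unused_successors n T \<sigma> i) < M})"
  define U where "U = (\<lambda>\<sigma> :: embedding. {u \<in> pool n. snd (snd \<sigma>) u = 0})"
  have G: "inj_on (fst \<sigma>) (reached M i)" "snd (snd \<sigma>) u = (if u \<in> fst \<sigma> ` reached M i then 1 else 0)"
    "fst \<sigma> ` (reached M i - {0}) \<subseteq> pool n" "fst \<sigma> 0 = x" if "\<sigma> \<in> G" for \<sigma> u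
  proof -
    obtain T where T: "greedy_succeeds M n T x i" "\<sigma> = greedy M n T x i"
      using \<open>\<sigma> \<in> G\<close> unfolding G_def by blast
    note facts = embeds_facts[OF greedy_embeds[OF T(1)], folded T(2)]
    show "inj_on (fst \<sigma>) (reached M i)" "snd (snd \<sigma>) u = (if u \<in> fst \<sigma> ` reached M i then 1 else 0)"
      "fst \<sigma> ` (reached M i - {0}) \<subseteq> pool n" "fst \<sigma> 0 = x"
      by (rule facts)+
  qed
  have "prob {T. greedy_succeeds M n T x i \<and> T \<in> F (greedy M n T x i)} \<le> 2 ^ M * exp (- \<delta> * n / 32)"
  proof (rule prob_adaptive_le[where G = G and C = "exposed M n i" and D = "\<lambda>\<sigma>. Pair (fst \<sigma> i) ` U \<sigma>"])
    fix \<sigma> assume \<sigma>: "\<sigma> \<in> G"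
    let ?R = "reached M i"
    have i_in: "i \<in> ?R" using i(1) by (rule self_in_reached)
    show "determined_by {T. greedy_succeeds M n T x i \<and> greedy M n T x i = \<sigma>} (exposed M n i \<sigma>)"
      unfolding determined_by_def using greedy_determined by blast
    show "determined_by (F \<sigma>) (Pair (fst \<sigma> i) ` U \<sigma>)"
      unfolding determined_by_def
    proof (intro allI impI)
      fix T T' assume "T \<in> F \<sigma>" and eq: "T \<inter> Pair (fst \<sigma> i) ` U \<sigma> = T' \<inter> Pair (fst \<sigma> i) ` U \<sigma>"
      have "unused_successors n T \<sigma> i = unused_successors n T' \<sigma> i"
        using eq unfolding unused_successors_def U_def by blast
      then show "T' \<in> F \<sigma>" using \<open>T \<in> F \<sigma>\<close> by (simp add: F_def)
    qed
    show "pair_key ` exposed M n i \<sigma> \<inter> pair_key ` Pair (fst \<sigma> i) ` U \<sigma> = {}"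
    proof (rule ccontr)
      assume "\<not> ?thesis"
      then obtain e e' where e': "e \<in> exposed M n i \<sigma>" "e' \<in> Pair (fst \<sigma> i) ` U \<sigma>"
        "pair_key e = pair_key e'" by blast
      then obtain u where e: "e \<in> exposed M n i \<sigma>" "u \<in> U \<sigma>" "pair_key e = pair_key (fst \<sigma> i, u)" by blast
      then obtain k u' where k: "e = (fst \<sigma> k, u')" "k < i" "k < 2 ^ M" by (auto simp: exposed_def)
      have "k \<in> ?R" using self_in_reached[OF k(3)] reached_mono[of k i M] k(2) by auto
      \<comment> \<open>An exposed pair starts at an earlier node. The alternative there is in use,
        hence not \<open>u\<close>, and differs from that of node \<open>i\<close> by
        injectivity.\<close>
      moreover have "fst \<sigma> k = fst \<sigma> i \<or> fst \<sigma> k = u" using pair_key_eqD[OF e(3)] k(1) by auto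
      ultimately show False
        using G(1,2)[OF \<sigma>] i_in k(2) e(2) by (auto simp: U_def inj_on_def split: if_splits)
    qed
    have v: "fst \<sigma> i < n"
      using G(3,4)[OF \<sigma>] i_in x pool_subset[of n] by (cases "i = 0") auto
    have "U \<sigma> \<subseteq> {..<n} - {fst \<sigma> i}"
      using pool_subset[of n] G(2)[OF \<sigma>] i_in by (auto simp: U_def)
    from prob_few_successors_le[OF model dense this v \<delta>(2)]
    have "prob (F \<sigma>) \<le> 2 ^ M * exp (- \<delta> * card (U \<sigma>) / 2)"
      unfolding F_def unused_successors_def U_def by simp
    also have "\<dots> \<le> 2 ^ M * exp (- \<delta> * n / 32)"
    proof -
      have "U \<sigma> = pool n - fst \<sigma> ` ?R" using G(2)[OF \<sigma>] by (auto simp: U_def)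
      then have "card (pool n) - card (fst \<sigma> ` ?R) \<le> card (U \<sigma>)"
        using diff_card_le_card_Diff[OF finite_imageI[OF finite_reached]] by metis
      moreover have "card (fst \<sigma> ` ?R) \<le> 2 ^ M"
        using card_image_le[OF finite_reached] card_reached le_trans by blast
      ultimately have "n \<le> 16 * card (U \<sigma>)"
        using card_pool(1)[of n] n by simp
      then have "\<delta> * n \<le> \<delta> * (16 * card (U \<sigma>))"
        using \<delta>(1) by (intro mult_left_mono) linarith+
      then show ?thesis by simp
    qed
    finally show "prob (F \<sigma>) \<le> 2 ^ M * exp (- \<delta> * n / 32)" .
  qed (auto simp: G_def)
  then show ?thesis by (simp add: F_def)
qed

lemma prob_greedy_fails:
  assumes x: "x < n"
  shows "prob {T. \<not> greedy_succeeds M n T x n} \<le> 2 ^ M * (2 ^ M * exp (- \<delta> * n / 32))"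
proof -
  define B where "B = (\<lambda>i. {T. even i \<and> greedy_succeeds M n T x i \<and>
    card (unused_successors n T (greedy M n T x i) i) < M})"
  have fails: "\<exists>i<2 ^ M. T \<in> B i" if "\<not> greedy_succeeds M n T x j" for T j
    using that
  proof (induction j)
    case (Suc j)
    show ?case
    proof (cases "greedy_succeeds M n T x j")
      case True
      then have "even j \<and> j < 2 ^ M \<and> T \<in> B j"
        using Suc.prems by (auto simp: greedy_succeeds_def B_def less_Suc_eq)
      then show ?thesis by blast
    qed (use Suc.IH in blast)
  qed (simp add: greedy_succeeds_def)
  have B: "prob (B i) \<le> 2 ^ M * exp (- \<delta> * n / 32)" if "i < 2 ^ M" for i
    using prob_greedy_step_fails[OF x that] by (cases "even i") (simp_all add: B_def)
  have "prob {T. \<not> greedy_succeeds M n T x n} \<le> prob (\<Union>i<2 ^ M. B i)"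
    using fails by (intro measure_pmf.finite_measure_mono) auto
  also have "\<dots> \<le> (\<Sum>i<2 ^ M. prob (B i))"
    by (rule measure_pmf.finite_measure_subadditive_finite) auto
  also have "\<dots> \<le> 2 ^ M * (2 ^ M * exp (- \<delta> * n / 32))"
    using sum_bounded_above[of "{..<2 ^ M}" "\<lambda>i. prob (B i)" "2 ^ M * exp (- \<delta> * n / 32)"] B by simp
  finally show ?thesis .
qed

text \<open>The side condition avoids \<open>exposed\<close>, whose pairs start at even nodes and
  end in the pool.\<close>

definition fresh :: "embedding \<Rightarrow> nat set \<Rightarrow> nat set \<Rightarrow> (nat \<times> nat) set" where
  "fresh \<sigma> X Y = {(fst \<sigma> i, y) | i y. i \<in> X \<and> y \<in> Y \<and> (odd i \<or> y \<notin> pool n)}"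

definition unused :: "embedding \<Rightarrow> nat set" where
  "unused \<sigma> = {y. y < n \<and> snd (snd \<sigma>) y = 0}"

definition candidates :: "embedding \<Rightarrow> nat \<Rightarrow> (nat set \<times> nat set) set" where
  "candidates \<sigma> a = {X. X \<subseteq> {..<2 ^ M} \<and> card X = a} \<times> {Y. Y \<subseteq> unused \<sigma> \<and> card Y = 2 ^ M + 1 - a}"

text \<open>Edges are forbidden on fresh pairs only. This enlarges the event, but makes it
  independent of the search for the tree.\<close>

definition hall_obstructed :: "embedding \<Rightarrow> (nat \<times> nat) set set" where
  "hall_obstructed \<sigma> = (\<Union>a\<in>{1..2 ^ M}. \<Union>(X, Y)\<in>candidates \<sigma> a. {T. T \<inter> fresh \<sigma> X Y = {}})"

lemma not_hall_obstructed:
  assumes "\<not> hall (wants n T \<sigma>) (2 ^ M)" "card (unused \<sigma>) = 2 ^ M"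
  shows "T \<in> hall_obstructed \<sigma>"
proof -
  obtain Z where Z: "Z \<subseteq> {1..2 ^ M}" "card (\<Union>(wants n T \<sigma> ` Z)) < card Z"
    using assms(1) by (auto simp: hall_def not_le)
  define N where "N = \<Union>(wants n T \<sigma> ` Z)"
  define X where "X = (\<lambda>c. c - 1) ` Z"
  define a where "a = card Z"
  have "inj_on (\<lambda>c. c - 1) Z"
  proof (rule inj_onI)
    fix c d assume "c \<in> Z" "d \<in> Z" "c - 1 = d - 1"
    moreover from this have "1 \<le> c" "1 \<le> d" using Z(1) by auto
    ultimately show "c = d" by linarith
  qed
  then have X: "X \<subseteq> {..<2 ^ M}" "card X = a"
  proof -
    have "c - 1 < 2 ^ M" if "c \<in> Z" for c
    proof -
      have "1 \<le> c" "c \<le> 2 ^ M" using that Z(1) by auto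
      then show ?thesis by linarith
    qed
    then show "X \<subseteq> {..<2 ^ M}" "card X = a"
      using \<open>inj_on (\<lambda>c. c - 1) Z\<close> by (auto simp: X_def a_def card_image)
  qed
  have a: "1 \<le> a" "a \<le> 2 ^ M"
    using Z card_mono[OF _ Z(1)] by (auto simp: a_def)
  have fin: "finite (unused \<sigma>)" by (simp add: unused_def)
  have N: "N \<subseteq> unused \<sigma>" by (auto simp: N_def wants_def unused_def)
  have "card (unused \<sigma> - N) = 2 ^ M - card N"
    using card_Diff_subset[OF finite_subset[OF N fin] N] assms(2) by simp
  then have "2 ^ M + 1 - a \<le> card (unused \<sigma> - N)"
    using Z(2) by (simp add: N_def a_def)
  then obtain Y where Y: "Y \<subseteq> unused \<sigma> - N" "card Y = 2 ^ M + 1 - a"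
    by (meson obtain_subset_with_card_n)
  have "(fst \<sigma> i, y) \<notin> T" if "i \<in> X" "y \<in> Y" for i y
    using that Y(1) by (auto simp: X_def N_def wants_def unused_def)
  then have "T \<inter> fresh \<sigma> X Y = {}" by (auto simp: fresh_def)
  moreover have "(X, Y) \<in> candidates \<sigma> a" using X Y by (auto simp: candidates_def)
  ultimately show ?thesis using a unfolding hall_obstructed_def by fastforce
qed

text \<open>
  Only pairs in the product of the even elements of \<open>X\<close> (at most half of all nodes) and the pool
  elements of \<open>Y\<close> (about an eighth of the unused alternatives) are not fresh; as \<open>X\<close> and \<open>Y\<close>
  cannot both be small, one of these two restrictions discards a constant fraction.
\<close>

lemma card_fresh:
  assumes \<sigma>: "embeds M n T x {..<2 ^ M} \<sigma>" and M: "M \<ge> 6"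
    and XY: "X \<subseteq> {..<2 ^ M}" "Y \<subseteq> unused \<sigma>" and card: "card X + card Y = 2 ^ M + 1"
  shows "card X * card Y \<le> 3 * card (fresh \<sigma> X Y)"
proof -
  define m where "m = (2::nat) ^ M"
  have nm: "n = 2 * m" by (simp add: n m_def)
  have "(2::nat) ^ 6 \<le> 2 ^ M" using M by (intro power_increasing) auto
  then have m: "m \<ge> 64" by (simp add: m_def)
  have "even m" using M by (simp add: m_def)
  note emb = embeds_facts[OF \<sigma>, folded m_def]
  have fin: "finite X" "finite Y" using XY finite_subset[of X] finite_subset[of Y] by (auto simp: unused_def)
  define Xe where "Xe = {i \<in> X. even i}"
  define Yp where "Yp = {y \<in> Y. y \<in> pool n}"
  have "fresh \<sigma> X Y = (\<lambda>(i, y). (fst \<sigma> i, y)) ` (X \<times> Y - Xe \<times> Yp)"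
    by (auto simp: fresh_def Xe_def Yp_def image_iff)
  moreover have "inj_on (\<lambda>(i, y). (fst \<sigma> i, y)) (X \<times> Y - Xe \<times> Yp)"
    using emb(1) XY(1) by (auto simp: inj_on_def m_def)
  moreover have "card (X \<times> Y - Xe \<times> Yp) = card X * card Y - card Xe * card Yp"
    using fin by (subst card_Diff_subset) (auto simp: Xe_def Yp_def card_cartesian_product)
  ultimately have fresh: "card (fresh \<sigma> X Y) = card X * card Y - card Xe * card Yp"
    by (simp add: card_image)
  have le: "card Xe \<le> card X" "card Yp \<le> card Y"
    using fin by (auto simp: Xe_def Yp_def intro: card_mono)
  have "2 * card Xe \<le> m"
  proof -
    have "Xe \<subseteq> (\<lambda>i. 2 * i) ` {..<m div 2}"
    proof
      fix i assume "i \<in> Xe"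
      then have "even i" "i < m" using XY(1) by (auto simp: Xe_def m_def)
      then have "i = 2 * (i div 2)" "i div 2 < m div 2" using \<open>even m\<close> by presburger+
      then show "i \<in> (\<lambda>i. 2 * i) ` {..<m div 2}" by blast
    qed
    then have "card Xe \<le> card ((\<lambda>i. 2 * i) ` {..<m div 2})" by (rule card_mono[rotated]) simp
    also have "\<dots> \<le> m div 2" using card_image_le[of "{..<m div 2}"] by force
    finally show ?thesis by linarith
  qed
  \<comment> \<open>The pool has at most \<open>9 m / 8 + 15 / 16\<close> elements, and
    \<open>m - 1\<close> of them are in the tree. The remaining \<open>m / 8 + 31 / 16\<close> are
    at most \<open>m / 6\<close> once \<open>m \<ge> 64\<close>, whence
    \<open>M \<ge> 6\<close>.\<close>
  moreover have "6 * card Yp \<le> m"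
  proof -
    have sub: "fst \<sigma> ` ({..<m} - {0}) \<subseteq> pool n" by (rule emb(3))
    have "Yp \<subseteq> pool n - fst \<sigma> ` ({..<m} - {0})"
      using XY(2) emb(2) by (auto simp: Yp_def unused_def split: if_splits)
    then have "card Yp \<le> card (pool n - fst \<sigma> ` ({..<m} - {0}))"
      using finite_pool by (intro card_mono) auto
    also have "\<dots> = card (pool n) - (m - 1)"
      using sub finite_pool emb(1) m
      by (subst card_Diff_subset) (auto simp: finite_subset card_image inj_on_diff)
    finally show ?thesis using card_pool(2)[of n] m nm by linarith
  qed
  \<comment> \<open>The threshold \<open>m / 4\<close> balances the two cases: \<open>m / 6\<close>
    is two thirds of \<open>m / 4\<close>, and \<open>m / 2\<close> is two thirds of
    \<open>3 m / 4\<close>, which \<open>card X\<close> exceeds when \<open>card Y\<close> is below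
    the threshold.\<close>
  ultimately have "3 * (card Xe * card Yp) \<le> 2 * (card X * card Y)"
  proof (cases "4 * card Y \<ge> m")
    case True
    then have "3 * card Yp \<le> 2 * card Y" using \<open>6 * card Yp \<le> m\<close> by linarith
    from mult_le_mono[OF le(1) this] show ?thesis by (simp add: algebra_simps)
  next
    case False
    then have "3 * card Xe \<le> 2 * card X" using \<open>2 * card Xe \<le> m\<close> card by (simp add: m_def)
    from mult_le_mono[OF this le(2)] show ?thesis by (simp add: algebra_simps)
  qed
  then show ?thesis unfolding fresh by linarith
qed

text \<open>Let \<open>s = min a (m + 1 - a)\<close>. The larger of \<open>X\<close> and
  \<open>Y\<close> has at least \<open>(m + 1) / 2\<close> elements and at least a third of the
  pairs are fresh, which makes at least \<open>s n / 12\<close>. By \<open>100 / 12 > 8\<close> an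
  obstruction has probability at most \<open>n ^ (-8 s)\<close>; a level has at most
  \<open>n ^ (2 s)\<close> of them, and there are fewer than \<open>n\<close> levels.\<close>

lemma prob_hall_obstructed:
  assumes \<sigma>: "embeds M n T x {..<2 ^ M} \<sigma>" and x: "x < n" and M: "M \<ge> 6" and \<delta>_eq: "\<delta> = 100 * ln n / n"
  shows "prob (hall_obstructed \<sigma>) \<le> 1 / n ^ 5"
proof -
  define m where "m = (2::nat) ^ M"
  have nm: "n = 2 * m" and "m \<ge> 1" by (simp_all add: n m_def)
  have unused: "finite (unused \<sigma>)" "card (unused \<sigma>) = m"
    using card_unused[of M T x \<sigma>, folded n] \<sigma> x by (simp_all add: unused_def m_def)
  have one: "prob {T. T \<inter> fresh \<sigma> X Y = {}} \<le> (1 / n) ^ (8 * min a (m + 1 - a))"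
    if a: "a \<in> {1..m}" and XY: "(X, Y) \<in> candidates \<sigma> a" for a X Y
  proof -
    define s where "s = min a (m + 1 - a)"
    have X: "X \<subseteq> {..<2 ^ M}" "card X = a" and Y: "Y \<subseteq> unused \<sigma>" "card Y = m + 1 - a"
      using XY by (auto simp: candidates_def m_def)
    have used: "fst \<sigma> i < n \<and> snd (snd \<sigma>) (fst \<sigma> i) = 1" if "i \<in> X" for i
    proof -
      have "i \<in> {..<2 ^ M}" using that X by blast
      then show ?thesis
        using embeds_facts[OF \<sigma>] x pool_subset[of n] by (cases "i = 0") auto
    qed
    have "fresh \<sigma> X Y \<subseteq> {(i, j). i < n \<and> j < n \<and> i \<noteq> j}"
      using used Y(1) by (fastforce simp: fresh_def unused_def)
    moreover have "inj_on pair_key (fresh \<sigma> X Y)"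
    proof (rule inj_onI)
      fix e e' assume e: "e \<in> fresh \<sigma> X Y" "e' \<in> fresh \<sigma> X Y" "pair_key e = pair_key e'"
      have ends: "snd (snd \<sigma>) (fst e) = 1 \<and> snd (snd \<sigma>) (snd e) = 0" if "e \<in> fresh \<sigma> X Y" for e
        using that used Y(1) by (auto simp: fresh_def unused_def)
      from pair_key_eqD[OF e(3)] show "e = e'"
      proof
        assume "e = prod.swap e'"
        then show ?thesis using ends[OF e(1)] ends[OF e(2)] by simp
      qed
    qed
    ultimately have "prob {T. T \<inter> fresh \<sigma> X Y = {}} \<le> exp (- \<delta> * card (fresh \<sigma> X Y))"
      by (intro prob_no_edges_le[OF model dense _ _ \<delta>(2)])
    also have "\<dots> \<le> exp (- (8 * real s * ln n))"
    proof -
      have fr: "a * (m + 1 - a) \<le> 3 * card (fresh \<sigma> X Y)"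
        using card_fresh[OF \<sigma> M X(1) Y(1)] X(2) Y(2) a by (simp add: m_def)
      have "s * (m + 1) \<le> 2 * (a * (m + 1 - a))"
      proof -
        obtain b where b: "m + 1 = a + b" using a by (metis atLeastAtMost_iff le_Suc_ex trans_le_add1)
        then show ?thesis
          unfolding s_def by (cases "a \<le> b") (auto simp: min_def algebra_simps intro: mult_le_mono)
      qed
      then have "s * m \<le> 6 * card (fresh \<sigma> X Y)" using fr by (simp add: algebra_simps)
      then have "real s * m \<le> 6 * card (fresh \<sigma> X Y)" by (metis of_nat_le_iff of_nat_mult of_nat_numeral)
      moreover have "real n = 2 * real m" by (simp add: nm)
      ultimately have "real s * n / 12 \<le> card (fresh \<sigma> X Y)" by (simp add: mult.commute)
      then have "\<delta> * (real s * n / 12) \<le> \<delta> * card (fresh \<sigma> X Y)"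
        using \<delta>(1) by (rule mult_left_mono)
      moreover have "\<delta> * (real s * n / 12) = (100 / 12) * (real s * ln n)"
        using nm \<open>m \<ge> 1\<close> by (simp add: \<delta>_eq)
      moreover have "8 * (real s * ln n) \<le> (100 / 12) * (real s * ln n)"
        using nm \<open>m \<ge> 1\<close> by (intro mult_right_mono) auto
      ultimately have "8 * (real s * ln n) \<le> \<delta> * card (fresh \<sigma> X Y)" by linarith
      then show ?thesis by (simp add: mult.assoc)
    qed
    also have "\<dots> = (1 / n) ^ (8 * s)"
    proof -
      have "exp (- (8 * real s * ln n)) = exp (- ln n) ^ (8 * s)"
        by (simp add: exp_of_nat_mult[symmetric])
      then show ?thesis using nm \<open>m \<ge> 1\<close> by (simp add: exp_minus inverse_eq_divide)
    qed
    finally show ?thesis unfolding s_def .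
  qed
  have level: "prob (\<Union>(X, Y)\<in>candidates \<sigma> a. {T. T \<inter> fresh \<sigma> X Y = {}}) \<le> (1 / n) ^ 6"
    if a: "a \<in> {1..m}" for a
  proof -
    define s where "s = min a (m + 1 - a)"
    have "1 \<le> s" using a by (auto simp: s_def)
    have fin: "finite (candidates \<sigma> a)" using unused(1) by (simp add: candidates_def)
    have "card (candidates \<sigma> a) = (m choose a) * (m choose (m + 1 - a))"
      using unused by (simp add: candidates_def card_cartesian_product n_subsets m_def)
    also have "\<dots> \<le> m ^ s * m ^ s"
      using choose_complement_le[of a m] a unfolding s_def by (intro mult_le_mono) auto
    also have "\<dots> \<le> n ^ s * n ^ s" using nm by (intro mult_le_mono power_mono) auto
    finally have "card (candidates \<sigma> a) \<le> n ^ (2 * s)" by (simp add: power_add[symmetric] mult_2)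
    then have card: "real (card (candidates \<sigma> a)) \<le> real n ^ (2 * s)"
      by (metis of_nat_le_iff of_nat_power)
    have "prob (\<Union>(X, Y)\<in>candidates \<sigma> a. {T. T \<inter> fresh \<sigma> X Y = {}})
      \<le> (\<Sum>(X, Y)\<in>candidates \<sigma> a. prob {T. T \<inter> fresh \<sigma> X Y = {}})"
      using measure_pmf.finite_measure_subadditive_finite[OF fin,
          where A = "\<lambda>(X, Y). {T. T \<inter> fresh \<sigma> X Y = {}}" and M = "random_tournament n p"]
      by (simp add: case_prod_unfold)
    also have "\<dots> \<le> real (card (candidates \<sigma> a)) * (1 / n) ^ (8 * s)"
      using one[OF a] unfolding s_def by (intro sum_bounded_above) auto
    also have "\<dots> \<le> real n ^ (2 * s) * (1 / n) ^ (8 * s)"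
      using card by (intro mult_right_mono) auto
    also have "\<dots> = (1 / n) ^ (6 * s)"
    proof -
      have "8 * s = 2 * s + 6 * s" by simp
      then show ?thesis using nm \<open>m \<ge> 1\<close> by (simp only: power_add) (simp add: power_one_over)
    qed
    also have "\<dots> \<le> (1 / n) ^ 6"
      using nm \<open>m \<ge> 1\<close> \<open>1 \<le> s\<close> by (intro power_decreasing) auto
    finally show ?thesis .
  qed
  have "prob (hall_obstructed \<sigma>)
    \<le> (\<Sum>a\<in>{1..m}. prob (\<Union>(X, Y)\<in>candidates \<sigma> a. {T. T \<inter> fresh \<sigma> X Y = {}}))"
    unfolding hall_obstructed_def m_def
    by (rule measure_pmf.finite_measure_subadditive_finite) auto
  also have "\<dots> \<le> real m * (1 / n) ^ 6"
    using sum_bounded_above[of "{1..m}", OF level] by simp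
  also have "\<dots> \<le> real n * (1 / n) ^ 6" using nm by (intro mult_right_mono) auto
  also have "\<dots> = 1 / n ^ 5" using nm \<open>m \<ge> 1\<close> by (simp add: power_one_over eval_nat_numeral)
  finally show ?thesis .
qed

lemma prob_hall_fails:
  assumes x: "x < n" and M: "M \<ge> 6" and \<delta>_eq: "\<delta> = 100 * ln n / n"
  shows "prob {T. greedy_succeeds M n T x n \<and> \<not> hall (wants n T (greedy M n T x n)) (2 ^ M)} \<le> 1 / n ^ 5"
proof -
  define G where "G = {greedy M n T x n | T. greedy_succeeds M n T x n}"
  have emb: "embeds M n T x {..<2 ^ M} (greedy M n T x n)" if "greedy_succeeds M n T x n" for T
    using greedy_embeds[OF that] by (simp add: reached_full n)
  have "prob {T. greedy_succeeds M n T x n \<and> T \<in> hall_obstructed (greedy M n T x n)} \<le> 1 / n ^ 5"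
  proof (rule prob_adaptive_le[where G = G and C = "exposed M n n"
        and D = "\<lambda>\<sigma>. fresh \<sigma> {..<2 ^ M} (unused \<sigma>)"])
    fix \<sigma> assume \<sigma>: "\<sigma> \<in> G"
    then obtain T0 where T0: "embeds M n T0 x {..<2 ^ M} \<sigma>" using emb by (auto simp: G_def)
    show "determined_by {T. greedy_succeeds M n T x n \<and> greedy M n T x n = \<sigma>} (exposed M n n \<sigma>)"
      unfolding determined_by_def using greedy_determined by blast
    have sub: "fresh \<sigma> X Y \<subseteq> fresh \<sigma> {..<2 ^ M} (unused \<sigma>)" if "(X, Y) \<in> candidates \<sigma> a" for X Y a
      using that by (auto simp: candidates_def fresh_def)
    show "determined_by (hall_obstructed \<sigma>) (fresh \<sigma> {..<2 ^ M} (unused \<sigma>))"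
      unfolding determined_by_def
    proof (intro allI impI)
      fix T T' assume "T \<in> hall_obstructed \<sigma>"
        and eq: "T \<inter> fresh \<sigma> {..<2 ^ M} (unused \<sigma>) = T' \<inter> fresh \<sigma> {..<2 ^ M} (unused \<sigma>)"
      then obtain a X Y where *: "a \<in> {1..2 ^ M}" "(X, Y) \<in> candidates \<sigma> a" "T \<inter> fresh \<sigma> X Y = {}"
        by (auto simp: hall_obstructed_def)
      have "T' \<inter> fresh \<sigma> X Y = {}" using eq sub[OF *(2)] *(3) by blast
      then show "T' \<in> hall_obstructed \<sigma>" unfolding hall_obstructed_def using *(1,2) by blast
    qed
    show "pair_key ` exposed M n n \<sigma> \<inter> pair_key ` fresh \<sigma> {..<2 ^ M} (unused \<sigma>) = {}"
    proof (rule ccontr)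
      assume "\<not> ?thesis"
      then obtain e e' where e: "e \<in> exposed M n n \<sigma>" "e' \<in> fresh \<sigma> {..<2 ^ M} (unused \<sigma>)"
        "pair_key e = pair_key e'" by blast
      obtain k u where k: "e = (fst \<sigma> k, u)" "even k" "k < 2 ^ M" "u \<in> pool n"
        using e(1) by (auto simp: exposed_def)
      obtain i y where i: "e' = (fst \<sigma> i, y)" "i < 2 ^ M" "y \<in> unused \<sigma>" "odd i \<or> y \<notin> pool n"
        using e(2) by (auto simp: fresh_def)
      have "snd (snd \<sigma>) (fst \<sigma> k) = 1" using embeds_facts(2)[OF T0] k(3) by simp
      then have "fst \<sigma> k \<noteq> y" using i(3) by (auto simp: unused_def)
      \<comment> \<open>Equal keys in the same orientation mean the same pair; it would start at an
        even node and end in the pool, which \<open>fresh\<close> rules out.\<close>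
      then have "fst \<sigma> k = fst \<sigma> i" "u = y" using pair_key_eqD[OF e(3)] k(1) i(1) by auto
      moreover from this have "k = i" using embeds_facts(1)[OF T0] k(3) i(2) by (auto simp: inj_on_def)
      ultimately show False using k i by auto
    qed
    show "prob (hall_obstructed \<sigma>) \<le> 1 / n ^ 5"
      by (rule prob_hall_obstructed[OF T0 x M \<delta>_eq])
  qed (auto simp: G_def)
  moreover have "prob {T. greedy_succeeds M n T x n \<and> \<not> hall (wants n T (greedy M n T x n)) (2 ^ M)}
    \<le> prob {T. greedy_succeeds M n T x n \<and> T \<in> hall_obstructed (greedy M n T x n)}"
  proof (intro measure_pmf.finite_measure_mono subsetI)
    fix T assume "T \<in> {T. greedy_succeeds M n T x n \<and> \<not> hall (wants n T (greedy M n T x n)) (2 ^ M)}"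
    then have T: "greedy_succeeds M n T x n" "\<not> hall (wants n T (greedy M n T x n)) (2 ^ M)" by auto
    have "card (unused (greedy M n T x n)) = 2 ^ M"
      using card_unused[of M T x, folded n] emb[OF T(1)] x by (simp add: unused_def)
    then show "T \<in> {T. greedy_succeeds M n T x n \<and> T \<in> hall_obstructed (greedy M n T x n)}"
      using not_hall_obstructed[OF T(2)] T(1) by simp
  qed auto
  ultimately show ?thesis by linarith
qed

lemma prob_unsolvable:
  assumes M: "M \<ge> 6" and \<delta>_eq: "\<delta> = 100 * ln n / n"
  shows "prob {T. \<exists>x<n. \<not> solvable M T x} \<le> 2 * real n powr (- 1 / 8)"
proof -
  have "n \<ge> 1" by (simp add: n)
  then have pos: "real n > 0" "real n \<ge> 1" by simp_all
  have m: "(2::real) ^ M = real n / 2" by (simp add: n)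
  have each: "prob {T. \<not> solvable M T x} \<le> real n powr (- 9 / 8) + 1 / n ^ 5" if x: "x < n" for x
  proof -
    have "prob {T. \<not> solvable M T x} \<le> prob ({T. \<not> greedy_succeeds M n T x n} \<union>
      {T. greedy_succeeds M n T x n \<and> \<not> hall (wants n T (greedy M n T x n)) (2 ^ M)})"
      by (intro measure_pmf.finite_measure_mono) (auto simp: solvable_def n)
    also have "\<dots> \<le> prob {T. \<not> greedy_succeeds M n T x n} +
      prob {T. greedy_succeeds M n T x n \<and> \<not> hall (wants n T (greedy M n T x n)) (2 ^ M)}"
      by (rule measure_Un_le) auto
    also have "\<dots> \<le> 2 ^ M * (2 ^ M * exp (- \<delta> * n / 32)) + 1 / n ^ 5"
      by (intro add_mono prob_greedy_fails prob_hall_fails x M \<delta>_eq)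
    also have "2 ^ M * (2 ^ M * exp (- \<delta> * n / 32)) \<le> real n powr (- 9 / 8)"
    proof -
      have "exp (- \<delta> * n / 32) = real n powr (- 25 / 8)"
        using pos by (simp add: \<delta>_eq powr_def)
      then have "2 ^ M * (2 ^ M * exp (- \<delta> * n / 32)) = real n powr 1 * real n powr 1 * real n powr (- 25 / 8) / 4"
        using pos by (simp add: m)
      also have "\<dots> = real n powr (- 9 / 8) / 4"
        by (simp only: powr_add[symmetric]) simp
      also have "\<dots> \<le> real n powr (- 9 / 8)" by simp
      finally show ?thesis .
    qed
    finally show ?thesis by simp
  qed
  have "{T. \<exists>x<n. \<not> solvable M T x} = (\<Union>x<n. {T. \<not> solvable M T x})" by auto
  then have "prob {T. \<exists>x<n. \<not> solvable M T x} \<le> (\<Sum>x<n. prob {T. \<not> solvable M T x})"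
    using measure_pmf.finite_measure_subadditive_finite[of "{..<n}" "\<lambda>x. {T. \<not> solvable M T x}"
        "random_tournament n p"] by simp
  also have "\<dots> \<le> real n * (real n powr (- 9 / 8) + 1 / n ^ 5)"
    using sum_bounded_above[of "{..<n}" "\<lambda>x. prob {T. \<not> solvable M T x}"] each by simp
  also have "\<dots> = real n powr 1 * real n powr (- 9 / 8) + real n powr 1 * real n powr (- 5)"
  proof -
    have "real n powr (- 5) = 1 / real (n ^ 5)" "real n powr 1 = real n"
      using pos by (simp_all add: powr_minus_divide)
    then show ?thesis by (simp only: distrib_left)
  qed
  also have "\<dots> = real n powr (- 1 / 8) + real n powr (- 4)"
    by (simp only: powr_add[symmetric]) simp
  also have "\<dots> \<le> 2 * real n powr (- 1 / 8)"
    using powr_mono[of "- 4" "- 1 / 8" "real n"] pos by simp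
  finally show ?thesis .
qed

end

section \<open>Passage to the limit\<close>

lemma prob_solvable_tendsto:
  assumes "admissible_models p"
  shows "(\<lambda>M. measure_pmf.prob (random_tournament (2 ^ Suc M) (p (Suc M)))
    {T. \<forall>x<2 ^ Suc M. solvable M T x}) \<longlonglongrightarrow> 1"
proof (rule tendsto_sandwich[where f = "\<lambda>M. 1 - 2 * real (2 ^ Suc M) powr (- 1 / 8)" and h = "\<lambda>_. 1"])
  have "\<forall>\<^sub>F r in sequentially. \<forall>i<2 ^ r. \<forall>j<2 ^ r. i \<noteq> j \<longrightarrow>
        p r i j \<in> {100 * ln (2 ^ r) / 2 ^ r .. 1 - 100 * ln (2 ^ r) / 2 ^ r}"
    using assms by (simp add: admissible_models_def)
  then have "\<forall>\<^sub>F M in sequentially. \<forall>i<2 ^ Suc M. \<forall>j<2 ^ Suc M. i \<noteq> j \<longrightarrow>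
        p (Suc M) i j \<in> {100 * ln (2 ^ Suc M) / 2 ^ Suc M .. 1 - 100 * ln (2 ^ Suc M) / 2 ^ Suc M}"
    by (subst eventually_sequentially_Suc)
  then show "\<forall>\<^sub>F M in sequentially. 1 - 2 * real (2 ^ Suc M) powr (- 1 / 8) \<le>
    measure_pmf.prob (random_tournament (2 ^ Suc M) (p (Suc M))) {T. \<forall>x<2 ^ Suc M. solvable M T x}"
    using eventually_ge_at_top[of 6]
  proof eventually_elim
    case (elim M)
    define \<delta> where "\<delta> = 100 * ln (real (2 ^ Suc M)) / real (2 ^ Suc M)"
    have dense: "\<delta> \<le> p (Suc M) i j" if "i < 2 ^ Suc M" "j < 2 ^ Suc M" "i \<noteq> j" for i j
      using elim(1) that by (simp add: \<delta>_def)
    have model: "model_probabilities (2 ^ Suc M) (p (Suc M))"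
      using assms by (simp only: admissible_models_def)
    \<comment> \<open>That \<open>\<delta> \<le> 1\<close> is read off from a single probability
      lying between \<open>\<delta>\<close> and 1; this takes two distinct alternatives.\<close>
    have "(1::nat) < 2 ^ Suc M" by (rule one_less_power) auto
    then have "p (Suc M) 0 1 \<in> {0..1} \<and> p (Suc M) 0 1 + p (Suc M) 1 0 = 1"
      using model[unfolded model_probabilities_def, rule_format, of 0 1] by simp
    moreover have "\<delta> \<le> p (Suc M) 0 1" using \<open>1 < 2 ^ Suc M\<close> by (intro dense) auto
    ultimately have "\<delta> \<le> 1" by simp
    moreover have "0 \<le> \<delta>"
    proof -
      have "1 \<le> real (2 ^ Suc M)" using \<open>1 < 2 ^ Suc M\<close> by linarith
      then show ?thesis
        unfolding \<delta>_def by (intro divide_nonneg_nonneg mult_nonneg_nonneg ln_ge_zero) simp_all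
    qed
    ultimately interpret dense_model M "2 ^ Suc M" "p (Suc M)" \<delta>
      by unfold_locales (use model dense in auto)
    have "measure_pmf.prob (random_tournament (2 ^ Suc M) (p (Suc M))) {T. \<forall>x<2 ^ Suc M. solvable M T x} =
      1 - prob {T. \<exists>x<2 ^ Suc M. \<not> solvable M T x}"
      by (subst measure_pmf.prob_compl[symmetric]) (auto intro!: arg_cong[where f = "measure _"])
    then show ?case using prob_unsolvable[OF elim(2) \<delta>_def] by simp
  qed
  \<comment> \<open>The error term is geometric in \<open>M\<close>, with ratio
    \<open>2 powr (- 1 / 8) < 1\<close>.\<close>
  have "(\<lambda>M. real (2 ^ Suc M) powr (- 1 / 8)) = (\<lambda>M. (2 powr (- 1 / 8)) ^ Suc M)"
    by (simp add: powr_realpow[symmetric] powr_powr mult.commute fun_eq_iff del: power_Suc)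
  moreover have "(\<lambda>M. (2 powr (- 1 / 8) :: real) ^ Suc M) \<longlonglongrightarrow> 0"
    by (rule LIMSEQ_Suc, rule LIMSEQ_realpow_zero) (auto simp: powr_less_one)
  ultimately have "(\<lambda>M. real (2 ^ Suc M) powr (- 1 / 8)) \<longlonglongrightarrow> 0" by simp
  from tendsto_diff[OF tendsto_const tendsto_mult_left[OF this]]
  show "(\<lambda>M. 1 - 2 * real (2 ^ Suc M) powr (- 1 / 8)) \<longlonglongrightarrow> 1" by simp
qed auto

theorem theorem6:
  shows "(\<forall>p. admissible_models p \<longrightarrow>
            (\<lambda>r. measure_pmf.prob (random_tournament (2 ^ r) (p r))
                   {T. \<forall>x<2 ^ r. single_elimination_winner {..<2 ^ r} T x}) \<longlonglongrightarrow> 1) \<and>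
         (\<exists>c. polynomial_time c \<and>
            (\<forall>p. admissible_models p \<longrightarrow>
              (\<lambda>r. measure_pmf.prob (random_tournament (2 ^ r) (p r))
                     {T. computes_winning_brackets c r T}) \<longlonglongrightarrow> 1))"
proof -
  let ?c = "compile bracket_prog"
  have "computes_winning_brackets ?c (Suc M) T" if "\<forall>x<2 ^ Suc M. solvable M T x" for M T
    using that by (intro bracket_prog_computes) auto
  moreover have "single_elimination_winner {..<2 ^ r} T x"
    if "computes_winning_brackets ?c r T" "x < 2 ^ r" for r T x
    using that unfolding computes_winning_brackets_def single_elimination_winner_def by blast
  \<comment> \<open>Both limits are instances: a property implied by solvability for all
    \<open>x\<close> has a probability squeezed between one that tends to 1 and 1 itself. Passing to
    \<open>r = Suc M\<close> only drops \<open>r = 0\<close>.\<close>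
  moreover have tends: "(\<lambda>r. measure_pmf.prob (random_tournament (2 ^ r) (p r)) {T. P r T}) \<longlonglongrightarrow> 1"
    if p: "admissible_models p" and P: "\<And>M T. \<forall>x<2 ^ Suc M. solvable M T x \<Longrightarrow> P (Suc M) T" for p P
  proof (rule filterlim_sequentially_Suc[THEN iffD1])
    show "(\<lambda>M. measure_pmf.prob (random_tournament (2 ^ Suc M) (p (Suc M))) {T. P (Suc M) T}) \<longlonglongrightarrow> 1"
      by (rule tendsto_sandwich[OF _ _ prob_solvable_tendsto[OF p] tendsto_const])
        (auto intro!: always_eventually measure_pmf.finite_measure_mono P simp del: power_Suc)
  qed
  ultimately show ?thesis
    using polynomial_time_compile[OF wf_bracket_prog] by (intro conjI exI[of _ ?c]) (auto simp del: power_Suc intro!: tends)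
qed

end
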